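(* Let $\Gamma=(X,\mathcal R)$ be a $Q$-polynomial distance-regular graph with diameter $D\ge 1$, path-length distance $\partial$, and dual eigenvalue sequence $\{\theta^*_i\}_{i=0}^D$, and let $\beta,\gamma,\gamma^*,\varrho,\varrho^*\in\mathbb R$ be scalars satisfying conditions (i)–(iii) in the context. Let $V$ be the complex vector space with basis $X$ and $V^{\otimes 3}=V\otimes V\otimes V$. Then $V^{\otimes 3}$ becomes a module for the $S_3$-symmetric tridiagonal algebra $\mathbb T(\beta,\gamma,\gamma^*,\varrho,\varrho^* )$ (over $\mathbb C$) on which the generators act as follows: for $x,y,z\in X$, $A_1(x\otimes y\otimes z)=\sum_{\xi\in\Gamma(x)}\xi\otimes y\otimes z$, $A_2(x\otimes y\otimes z)=\sum_{\xi\in\Gamma(y)}x\otimes \xi\otimes z$, $A_3(x\otimes y\otimes z)=\sum_{\xi\in\Gamma(z)}x\otimes y\otimes \xi$, $A^*_1(x\otimes y\otimes z)=\theta^*_{\partial(y,z)}\,x\otimes y\otimes z$, $A^*_2(x\otimes y\otimes z)=\theta^*_{\partial(z,x)}\,x\otimes y\otimes z$, $A^*_3(x\otimes y\otimes z)=\theta^*_{\partial(x,y)}\,x\otimes y\otimes z$.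
   Context: For a field $\mathbb F$ and $\beta,\gamma,\gamma^*,\varrho,\varrho^*\in\mathbb F$, the $S_3$-symmetric tridiagonal algebra $\mathbb T=\mathbb T(\beta,\gamma,\gamma^*,\varrho,\varrho^* )$ is the associative unital $\mathbb F$-algebra with generators $A_i,A^*_i$ ($i\in\{1,2,3\}$) and relations: $[A_i,A_j]=0$ and $[A^*_i,A^*_j]=0$ for all $i,j$; $[A_i,A^*_i]=0$ for all $i$; and for distinct $i,j$: $[A_i, A_i^2A_j^*-\beta A_iA_j^*A_i+A_j^*A_i^2-\gamma(A_iA_j^*+A_j^*A_i)-\varrho A_j^*]=0$ and $[A_j^*, A_j^{*2}A_i-\beta A_j^*A_iA_j^*+A_iA_j^{*2}-\gamma^*(A_j^*A_i+A_iA_j^* )-\varrho^*A_i]=0$, where $[B,C]=BC-CB$. Graph setting: $\Gamma$ is distance-regular, $\Gamma(x)$ is the set of vertices adjacent to $x$. $\Gamma$ is $Q$-polynomial with respect to an ordering $E_0,\dots,E_D$ of the primitive idempotents of its adjacency matrix; $\theta_i$ is the eigenvalue with $AE_i=\theta_iE_i$, and the dual eigenvalues are $\theta^*_i=|X|(E_1)_{xy}$ for any $x,y$ with $\partial(x,y)=i$. The scalars satisfy: (i) $\beta+1=\frac{\theta_{i-2}-\theta_{i+1}}{\theta_{i-1}-\theta_i}=\frac{\theta^*_{i-2}-\theta^*_{i+1}}{\theta^*_{i-1}-\theta^*_i}$ for $2\le i\le D-1$; (ii) $\gamma=\theta_{i-1}-\beta\theta_i+\theta_{i+1}$ and $\gamma^*=\theta^*_{i-1}-\beta\theta^*_i+\theta^*_{i+1}$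 for $1\le i\le D-1$; (iii) $\varrho=\theta_{i-1}^2-\beta\theta_{i-1}\theta_i+\theta_i^2-\gamma(\theta_{i-1}+\theta_i)$ and $\varrho^*=\theta^{*2}_{i-1}-\beta\theta^*_{i-1}\theta^*_i+\theta^{*2}_i-\gamma^*(\theta^*_{i-1}+\theta^*_i)$ for $1\le i\le D$. (Such scalars exist for any $Q$-polynomial distance-regular graph.) *)

theory Defs
  imports
    "HOL-Analysis.Analysis"
    "HOL-Library.Poly_Mapping"
    "HOL-Algebra.QuotRing"
    "HOL-Algebra.Module"
begin

section \<open>Distance-regular graphs\<close>

text \<open>
  A graph on the finite vertex set \<open>UNIV :: 'v set\<close> is given by its adjacency relation
  \<open>R\<close>; a pair is in \<open>R ^^ n\<close> iff it is joined by a walk of length \<open>n\<close>.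
\<close>

definition connected_simple_graph :: "'v rel \<Rightarrow> bool" where
  "connected_simple_graph R \<longleftrightarrow> sym R \<and> irrefl R \<and> (\<forall>x y. (x, y) \<in> R\<^sup>*)"

definition nbhd :: "'v rel \<Rightarrow> 'v \<Rightarrow> 'v set" where
  "nbhd R x = {y. (x, y) \<in> R}"

definition gdist :: "'v rel \<Rightarrow> 'v \<Rightarrow> 'v \<Rightarrow> nat" where
  "gdist R x y = (LEAST n. (x, y) \<in> R ^^ n)"

definition gdiameter :: "'v::finite rel \<Rightarrow> nat" where
  "gdiameter R = Max {gdist R x y | x y. True}"

definition distance_regular :: "'v::finite rel \<Rightarrow> bool" where
  "distance_regular R \<longleftrightarrow> connected_simple_graph R \<and>
     (\<exists>p :: nat \<Rightarrow> nat \<Rightarrow> nat \<Rightarrow> nat.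
        \<forall>h \<le> gdiameter R. \<forall>i \<le> gdiameter R. \<forall>j \<le> gdiameter R. \<forall>x y. gdist R x y = h \<longrightarrow>
          card {z. gdist R x z = i \<and> gdist R z y = j} = p h i j)"

section \<open>Primitive idempotents and the Q-polynomial property\<close>

definition adj_matrix :: "'v::finite rel \<Rightarrow> complex ^ 'v ^ 'v" where
  "adj_matrix R = (\<chi> x y. if (x, y) \<in> R then 1 else 0)"

text \<open>
  \<open>P\<close> is the identity on one eigenspace of \<open>M\<close> and zero on all the others. For
  diagonalizable \<open>M\<close> (such as a symmetric real matrix) this determines \<open>P\<close>
  from the eigenspace.
\<close>

definition primitive_idempotent :: "complex ^ 'n ^ 'n \<Rightarrow> complex ^ 'n ^ 'n \<Rightarrow> bool" where
  "primitive_idempotent M P \<longleftrightarrow>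
     (\<exists>t. (\<exists>v. v \<noteq> 0 \<and> M *v v = t *s v) \<and>
          (\<forall>v. M *v v = t *s v \<longrightarrow> P *v v = v) \<and>
          (\<forall>s v. s \<noteq> t \<longrightarrow> M *v v = s *s v \<longrightarrow> P *v v = 0))"

text \<open>
  \<open>q h i j\<close> are the Krein parameters $q^h_{ij}$, defined by
  $E_i \circ E_j = |X|^{-1} \sum_h q^h_{ij} E_h$ with the entrywise product.
\<close>

definition krein_parameters ::
    "nat \<Rightarrow> (nat \<Rightarrow> complex ^ 'v::finite ^ 'v) \<Rightarrow> (nat \<Rightarrow> nat \<Rightarrow> nat \<Rightarrow> complex) \<Rightarrow> bool" where
  "krein_parameters D E q \<longleftrightarrow>
     (\<forall>i \<le> D. \<forall>j \<le> D. \<forall>x y.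
        E i $ x $ y * E j $ x $ y = (\<Sum>h\<le>D. q h i j * E h $ x $ y) / of_nat CARD('v))"

definition Q_polynomial :: "'v::finite rel \<Rightarrow> (nat \<Rightarrow> complex ^ 'v ^ 'v) \<Rightarrow> bool" where
  "Q_polynomial R E \<longleftrightarrow>
     (let D = gdiameter R in
       bij_betw E {0..D} {P. primitive_idempotent (adj_matrix R) P} \<and>
       E 0 = (\<chi> x y. 1 / of_nat CARD('v)) \<and>
       (\<exists>q. krein_parameters D E q \<and>
          (\<forall>h \<le> D. \<forall>i \<le> D. \<forall>j \<le> D.
             (h > i + j \<or> i > h + j \<or> j > h + i \<longrightarrow> q h i j = 0) \<and>
             (h = i + j \<or> i = h + j \<or> j = h + i \<longrightarrow> q h i j \<noteq> 0))))"

section \<open>Free associative algebras\<close>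

datatype 'g free_word = Word (letters: "'g list")

instantiation free_word :: (type) monoid_add
begin

definition zero_free_word :: "'a free_word" where
  "0 = Word []"

definition plus_free_word :: "'a free_word \<Rightarrow> 'a free_word \<Rightarrow> 'a free_word" where
  "v + w = Word (letters v @ letters w)"

instance
  by standard (simp_all add: zero_free_word_def plus_free_word_def)

end

text \<open>
  Words under concatenation are written additively because the convolution product on
  \<open>\<Rightarrow>\<^sub>0\<close> requires this; it makes the type below the monoid algebra of the free monoid.
\<close>

type_synonym ('g, 'f) free_algebra = "'g free_word \<Rightarrow>\<^sub>0 'f"

definition free_gen :: "'g \<Rightarrow> ('g, 'f::field) free_algebra" where
  "free_gen g = Poly_Mapping.single (Word [g]) 1"

definition free_const :: "'f::field \<Rightarrow> ('g, 'f) free_algebra" where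
  "free_const c = Poly_Mapping.single 0 c"

definition free_algebra_ring :: "('g, 'f::field) free_algebra ring" where
  "free_algebra_ring = \<lparr>carrier = UNIV, mult = (*), one = 1, zero = 0, add = (+)\<rparr>"

lemma ring_free_algebra_ring:
  "Ring.ring (free_algebra_ring :: ('g, 'f::field) free_algebra ring)"
proof (rule ringI)
  show "abelian_group (free_algebra_ring :: ('g, 'f) free_algebra ring)"
  proof (rule abelian_groupI)
    fix x :: "('g, 'f) free_algebra"
    show "\<exists>y\<in>carrier free_algebra_ring. y \<oplus>\<^bsub>free_algebra_ring\<^esub> x = \<zero>\<^bsub>free_algebra_ring\<^esub>"
      by (rule bexI[of _ "- x"]) (simp_all add: free_algebra_ring_def)
  qed (simp_all add: free_algebra_ring_def add.assoc add.commute)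
  show "Group.monoid (free_algebra_ring :: ('g, 'f) free_algebra ring)"
    by (rule monoidI) (simp_all add: free_algebra_ring_def mult.assoc)
qed (simp_all add: free_algebra_ring_def distrib_left distrib_right)

text \<open>
  The algebra with generators \<open>'g\<close> and relators \<open>S\<close>: the quotient of the free algebra by
  the two-sided ideal generated by \<open>S\<close>.
\<close>

definition presented_class ::
    "('g, 'f::field) free_algebra set \<Rightarrow> ('g, 'f) free_algebra \<Rightarrow> ('g, 'f) free_algebra set" where
  "presented_class S p = genideal free_algebra_ring S +>\<^bsub>free_algebra_ring\<^esub> p"

definition presented_algebra ::
    "('g, 'f::field) free_algebra set \<Rightarrow> ('f, ('g, 'f) free_algebra set) module" where
  "presented_algebra S =
     (let Q = free_algebra_ring Quot genideal free_algebra_ring S in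
       \<lparr>carrier = carrier Q, mult = mult Q, one = one Q, zero = zero Q, add = add Q,
        smult = (\<lambda>c t. presented_class S (free_const c) \<otimes>\<^bsub>Q\<^esub> t)\<rparr>)"

text \<open>
  Left modules over a unital associative algebra \<open>T\<close>, the underlying vector space being the
  whole type \<open>'w\<close> with scalar multiplication \<open>scl\<close>.
\<close>

definition left_algebra_module ::
    "('f::field, 't) module \<Rightarrow> ('f \<Rightarrow> 'w::ab_group_add \<Rightarrow> 'w) \<Rightarrow> ('t \<Rightarrow> 'w \<Rightarrow> 'w) \<Rightarrow> bool" where
  "left_algebra_module T scl act \<longleftrightarrow>
     vector_space scl \<and>
     (\<forall>t \<in> carrier T. Vector_Spaces.linear scl scl (act t)) \<and>
     (\<forall>t \<in> carrier T. \<forall>u \<in> carrier T. \<forall>w. act (t \<oplus>\<^bsub>T\<^esub> u) w = act t w + act u w) \<and>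
     (\<forall>c. \<forall>t \<in> carrier T. \<forall>w. act (c \<odot>\<^bsub>T\<^esub> t) w = scl c (act t w)) \<and>
     (\<forall>t \<in> carrier T. \<forall>u \<in> carrier T. \<forall>w. act (t \<otimes>\<^bsub>T\<^esub> u) w = act t (act u w)) \<and>
     (\<forall>w. act \<one>\<^bsub>T\<^esub> w = w)"

section \<open>The $S_3$-symmetric tridiagonal algebra\<close>

text \<open>The index type \<open>3\<close> has exactly the elements \<open>1\<close>, \<open>2\<close>, \<open>3\<close>.\<close>

datatype s3_gen = GenA 3 | GenAs 3

definition commutator :: "'a::ring \<Rightarrow> 'a \<Rightarrow> 'a" where
  "commutator a b = a * b - b * a"

definition tridiagonal_relator :: "'a::ring \<Rightarrow> 'a \<Rightarrow> 'a \<Rightarrow> 'a \<Rightarrow> 'a \<Rightarrow> 'a" where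
  "tridiagonal_relator b g r x y =
     commutator x (x * x * y - b * (x * y * x) + y * x * x - g * (x * y + y * x) - r * y)"

definition s3_relators ::
    "'f::field \<Rightarrow> 'f \<Rightarrow> 'f \<Rightarrow> 'f \<Rightarrow> 'f \<Rightarrow> (s3_gen, 'f) free_algebra set" where
  "s3_relators \<beta> \<gamma> \<gamma>s \<rho> \<rho>s =
     (let A = (\<lambda>i. free_gen (GenA i)); As = (\<lambda>i. free_gen (GenAs i)) in
       {commutator (A i) (A j) | i j. True} \<union>
       {commutator (As i) (As j) | i j. True} \<union>
       {commutator (A i) (As i) | i. True} \<union>
       {tridiagonal_relator (free_const \<beta>) (free_const \<gamma>) (free_const \<rho>) (A i) (As j)
          | i j. i \<noteq> j} \<union>
       {tridiagonal_relator (free_const \<beta>) (free_const \<gamma>s) (free_const \<rho>s) (As j) (A i)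
          | i j. i \<noteq> j})"

definition s3_tridiagonal_algebra ::
    "'f::field \<Rightarrow> 'f \<Rightarrow> 'f \<Rightarrow> 'f \<Rightarrow> 'f \<Rightarrow> ('f, (s3_gen, 'f) free_algebra set) module" where
  "s3_tridiagonal_algebra \<beta> \<gamma> \<gamma>s \<rho> \<rho>s = presented_algebra (s3_relators \<beta> \<gamma> \<gamma>s \<rho> \<rho>s)"

definition s3_generator ::
    "'f::field \<Rightarrow> 'f \<Rightarrow> 'f \<Rightarrow> 'f \<Rightarrow> 'f \<Rightarrow> s3_gen \<Rightarrow> (s3_gen, 'f) free_algebra set" where
  "s3_generator \<beta> \<gamma> \<gamma>s \<rho> \<rho>s g = presented_class (s3_relators \<beta> \<gamma> \<gamma>s \<rho> \<rho>s) (free_gen g)"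

section \<open>The space $V \otimes V \otimes V$\<close>

text \<open>
  \<open>V\<close> is \<open>complex ^ 'v\<close>, a vertex \<open>x\<close> being identified with the basis vector \<open>axis x 1\<close>.
  The threefold tensor power is modelled on \<open>complex ^ ('v \<times> 'v \<times> 'v)\<close>; the universal
  property is proved below.
\<close>

definition tensor3 ::
    "complex ^ 'v \<Rightarrow> complex ^ 'v \<Rightarrow> complex ^ 'v \<Rightarrow> complex ^ ('v::finite \<times> 'v \<times> 'v)" where
  "tensor3 u v w = (\<chi> p. u $ fst p * v $ fst (snd p) * w $ snd (snd p))"

definition vertex_tensor :: "'v::finite \<Rightarrow> 'v \<Rightarrow> 'v \<Rightarrow> complex ^ ('v \<times> 'v \<times> 'v)" where
  "vertex_tensor x y z = tensor3 (axis x 1) (axis y 1) (axis z 1)"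

lemma vertex_tensor_eq_axis: "vertex_tensor x y z = axis (x, y, z) 1"
  by (auto simp: vertex_tensor_def tensor3_def axis_def vec_eq_iff)

lemma tensor3_universal:
  fixes scl :: "complex \<Rightarrow> 'w::ab_group_add \<Rightarrow> 'w"
    and f :: "complex ^ 'v::finite \<Rightarrow> complex ^ 'v \<Rightarrow> complex ^ 'v \<Rightarrow> 'w"
  assumes l1: "\<And>v w. Vector_Spaces.linear (*s) scl (\<lambda>u. f u v w)"
    and l2: "\<And>u w. Vector_Spaces.linear (*s) scl (\<lambda>v. f u v w)"
    and l3: "\<And>u v. Vector_Spaces.linear (*s) scl (\<lambda>w. f u v w)"
  shows "\<exists>!g. Vector_Spaces.linear (*s) scl g \<and> (\<forall>u v w. g (tensor3 u v w) = f u v w)"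
proof -
  interpret W: vector_space scl
    using l1[of 0 0] by (simp add: Vector_Spaces.linear_def)
  have expand: "h t = (\<Sum>p\<in>UNIV. scl (t $ p) (h (axis p 1)))"
    if "Vector_Spaces.linear (*s) scl h" for h and t :: "complex ^ 'k::finite"
  proof -
    interpret h: Vector_Spaces.linear "(*s)" scl h by (rule that)
    have "h t = h (\<Sum>p\<in>UNIV. t $ p *s axis p 1)"
      by (simp add: basis_expansion)
    then show ?thesis by (simp add: h.sum h.scale)
  qed
  define g where "g t = (\<Sum>p\<in>UNIV. scl (t $ p)
      (f (axis (fst p) 1) (axis (fst (snd p)) 1) (axis (snd (snd p)) 1)))"
    for t :: "complex ^ ('v \<times> 'v \<times> 'v)"
  have lin: "Vector_Spaces.linear (*s) scl g"
    by unfold_locales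
      (simp_all add: g_def W.scale_left_distrib sum.distrib W.scale_sum_right
        vec.scale_right_distrib vec.scale_left_distrib)
  have val: "g (tensor3 u v w) = f u v w" for u v w
  proof -
    have "f u v w = (\<Sum>x\<in>UNIV. scl (u $ x) (\<Sum>y\<in>UNIV. scl (v $ y)
        (\<Sum>z\<in>UNIV. scl (w $ z) (f (axis x 1) (axis y 1) (axis z 1)))))"
    proof -
      have "f u v w = (\<Sum>x\<in>UNIV. scl (u $ x) (f (axis x 1) v w))"
        by (rule expand[OF l1])
      moreover have "f (axis x 1) v w = (\<Sum>y\<in>UNIV. scl (v $ y) (f (axis x 1) (axis y 1) w))" for x
        by (rule expand[OF l2])
      moreover have "f (axis x 1) (axis y 1) w =
          (\<Sum>z\<in>UNIV. scl (w $ z) (f (axis x 1) (axis y 1) (axis z 1)))" for x y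
        by (rule expand[OF l3])
      ultimately show ?thesis by presburger
    qed
    also have "\<dots> = (\<Sum>x\<in>UNIV. \<Sum>y\<in>UNIV. \<Sum>z\<in>UNIV. scl (u $ x * v $ y * w $ z)
        (f (axis x 1) (axis y 1) (axis z 1)))"
      by (simp add: W.scale_sum_right mult.assoc)
    also have "\<dots> = g (tensor3 u v w)"
      by (simp only: g_def tensor3_def sum.cartesian_product UNIV_Times_UNIV split_def vec_lambda_beta)
    finally show ?thesis ..
  qed
  have uniq: "h = g" if h: "Vector_Spaces.linear (*s) scl h"
      "\<forall>u v w. h (tensor3 u v w) = f u v w" for h
  proof
    fix t
    have "h (axis p 1) = f (axis (fst p) 1) (axis (fst (snd p)) 1) (axis (snd (snd p)) 1)" for p
      using h(2)[rule_format, of "axis (fst p) 1" "axis (fst (snd p)) 1" "axis (snd (snd p)) 1"]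
        vertex_tensor_eq_axis[of "fst p" "fst (snd p)" "snd (snd p)"]
      unfolding vertex_tensor_def by simp
    then show "h t = g t" unfolding g_def by (subst expand[OF h(1)]) simp
  qed
  show ?thesis using lin val uniq by blast
qed

end

theory Submission
  imports Defs "HOL-Computational_Algebra.Fundamental_Theorem_Algebra"
begin

text \<open>
  For \<open>i \<noteq> j\<close> the operators $A_i$ and $A^*_j$ preserve the slices of the tensor space obtained by
  fixing the two coordinates other than \<open>i\<close>. On a slice, $A_i$ is the adjacency matrix \<open>A\<close> and
  $A^*_j$ is the diagonal matrix $A^*(z)$ with entries $\theta^*_{\partial(z,x)}$, where \<open>z\<close> is the
  fixed coordinate of index other than \<open>j\<close>. So the tridiagonal relations reduce to those for
  \<open>A\<close> and $A^*(z)$. One of them holds entrywise, because distances to \<open>z\<close> differ by at most one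
  along an edge. The other one is checked on $E_i \cdots E_j$: it contains the factor
  $E_i A^*(z) E_j$, and this vanishes for $|i - j| > 1$ because the Krein parameter $q^1_{ij}$ does.
\<close>

section \<open>Diagonalization of real symmetric matrices\<close>

lemma mat_mult_vector: "mat c *v v = c *s (v :: 'a::semiring_1 ^ 'n)"
  by (simp add: mat_def matrix_vector_mult_def vec_eq_iff if_distrib if_distribR cong: if_cong)

text \<open>The vector \<open>p(M) v\<close>, computed by the Horner scheme. Only the action on a
  vector is tracked, so no polynomial in matrices has to be formed.\<close>

definition poly_matrix_act :: "complex ^ 'n ^ 'n \<Rightarrow> complex poly \<Rightarrow> complex ^ 'n \<Rightarrow> complex ^ 'n" where
  "poly_matrix_act M p = fold_coeffs (\<lambda>a f v. a *s v + M *v f v) p (\<lambda>v. 0)"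

lemma poly_matrix_act_0 [simp]: "poly_matrix_act M 0 v = 0"
  by (simp add: poly_matrix_act_def)

lemma poly_matrix_act_pCons [simp]:
  "poly_matrix_act M (pCons a p) v = a *s v + M *v poly_matrix_act M p v"
  by (cases "p = 0 \<and> a = 0") (auto simp: poly_matrix_act_def vec_eq_iff)

lemma poly_matrix_act_add:
  "poly_matrix_act M (p + q) v = poly_matrix_act M p v + poly_matrix_act M q v"
  by (induction p q rule: poly_induct2)
    (simp_all add: matrix_vector_right_distrib vector_sadd_rdistrib algebra_simps)

lemma poly_matrix_act_smult:
  "poly_matrix_act M (Polynomial.smult c p) v = c *s poly_matrix_act M p v"
  by (induction p) (simp_all add: vector_scalar_commute vector_smult_assoc vector_add_ldistrib)

lemma poly_matrix_act_diff:
  "poly_matrix_act M (p - q) v = poly_matrix_act M p v - poly_matrix_act M q v"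
  using poly_matrix_act_add[of M "p - q" q v] by (simp add: algebra_simps)

lemma poly_matrix_act_sum:
  "poly_matrix_act M (\<Sum>i\<in>I. p i) v = (\<Sum>i\<in>I. poly_matrix_act M (p i) v)"
  by (induction I rule: infinite_finite_induct) (simp_all add: poly_matrix_act_add)

lemma poly_matrix_act_monom:
  "poly_matrix_act M (monom c k) v = c *s (((*v) M) ^^ k) v"
  by (induction k) (simp_all add: monom_0 monom_Suc vector_scalar_commute)

lemma poly_matrix_act_shift:
  "poly_matrix_act M p (M *v v - c *s v) = M *v poly_matrix_act M p v - c *s poly_matrix_act M p v"
  by (induction p)
    (simp_all add: matrix_vector_right_distrib matrix_vector_mult_diff_distrib vector_scalar_commute
      vector_smult_assoc vector_add_ldistrib vector_ssub_ldistrib mult.commute)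

lemma poly_matrix_act_linear_factor:
  "poly_matrix_act M ([:- c, 1:] * p) v = poly_matrix_act M p (M *v v - c *s v)"
  by (simp add: poly_matrix_act_shift poly_matrix_act_diff poly_matrix_act_smult)

text \<open>The Krylov vectors v, M v, ..., M^n v are one more than the dimension n, so they satisfy
  a nontrivial linear relation, whose coefficients are those of \<open>p\<close>.\<close>

lemma exists_annihilating_poly:
  fixes M :: "complex ^ 'n ^ 'n"
  shows "\<exists>p. p \<noteq> 0 \<and> poly_matrix_act M p v = 0"
proof -
  define f where "f k = (((*v) M) ^^ k) v" for k
  let ?K = "{..CARD('n)}"
  show ?thesis
  proof (cases "inj_on f ?K")
    \<comment> \<open>Coinciding Krylov vectors do not make their set dependent, so a repetition is
      treated separately, with the polynomial t^i - t^j.\<close>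
    case False
    then obtain i j where "i \<noteq> j" "f i = f j" by (auto simp: inj_on_def)
    moreover from \<open>i \<noteq> j\<close> have "coeff (monom 1 i + monom (- 1) j :: complex poly) i \<noteq> 0"
      by simp
    then have "monom 1 i + monom (- 1) j \<noteq> (0 :: complex poly)" by force
    ultimately show ?thesis
      by (intro exI[of _ "monom 1 i + monom (- 1) j"])
        (simp add: poly_matrix_act_add poly_matrix_act_monom f_def)
  next
    case True
    have "card (f ` ?K) > vec.dim (f ` ?K)"
      using card_image[OF True] dim_subset_UNIV_cart_gen[of "f ` ?K"] by simp
    then have "vec.dependent (f ` ?K)"
      by (rule vec.dependent_biggerset_general)
    then obtain u where u: "\<exists>w\<in>f ` ?K. u w \<noteq> 0" "(\<Sum>w\<in>f ` ?K. u w *s w) = 0"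
      by (subst (asm) vec.dependent_finite) auto
    from u(1) obtain k where k: "k \<in> ?K" "u (f k) \<noteq> 0" by blast
    define p where "p = (\<Sum>k\<in>?K. monom (u (f k)) k)"
    have "coeff p k = u (f k)" using k by (simp add: p_def coeff_sum)
    then have "p \<noteq> 0" using k by auto
    moreover have "poly_matrix_act M p v = 0"
      using u(2) sum.reindex[OF True, of "\<lambda>w. u w *s w"]
      by (simp add: p_def poly_matrix_act_sum poly_matrix_act_monom f_def)
    ultimately show ?thesis by blast
  qed
qed

section \<open>The symmetric bilinear form and complex conjugation\<close>

definition bilin :: "complex ^ 'n \<Rightarrow> complex ^ 'n \<Rightarrow> complex" where
  "bilin u v = (\<Sum>x\<in>UNIV. u $ x * v $ x)"

definition conj_vec :: "complex ^ 'n \<Rightarrow> complex ^ 'n" where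
  "conj_vec v = (\<chi> x. cnj (v $ x))"

lemma bilin_simps:
  "bilin (u + u') v = bilin u v + bilin u' v" "bilin u (v + v') = bilin u v + bilin u v'"
  "bilin (u - u') v = bilin u v - bilin u' v" "bilin u (v - v') = bilin u v - bilin u v'"
  "bilin (c *s u) v = c * bilin u v" "bilin u (c *s v) = c * bilin u v"
  "bilin 0 v = 0" "bilin u 0 = 0"
  by (simp_all add: bilin_def algebra_simps sum.distrib sum_subtractf sum_distrib_left)

lemma bilin_axis: "bilin (axis x 1) v = v $ x" "bilin v (axis x 1) = v $ x"
  by (simp_all add: bilin_def axis_def if_distrib if_distribR sum.delta' cong: if_cong)

text \<open>\<open>bilin\<close> itself has isotropic vectors; conjugating one argument gives the
  Hermitian norm, the sum of the squared moduli of the entries.\<close>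

lemma bilin_conj_vec_eq_0: "bilin (conj_vec v) v = 0 \<longleftrightarrow> v = 0"
proof -
  have "bilin (conj_vec v) v = of_real (\<Sum>x\<in>UNIV. (cmod (v $ x))\<^sup>2)"
    by (simp add: bilin_def conj_vec_def complex_norm_square mult.commute del: of_real_power)
  then have "bilin (conj_vec v) v = 0 \<longleftrightarrow> (\<Sum>x\<in>UNIV. (cmod (v $ x))\<^sup>2) = 0"
    by (simp only: of_real_eq_0_iff)
  then show ?thesis
    by (simp add: sum_nonneg_eq_0_iff vec_eq_iff)
qed

lemma conj_vec_simps:
  "conj_vec (u + v) = conj_vec u + conj_vec v" "conj_vec (c *s v) = cnj c *s conj_vec v"
  "conj_vec 0 = 0" "conj_vec (conj_vec v) = v"
  by (simp_all add: conj_vec_def vec_eq_iff)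

locale real_symmetric_matrix =
  fixes M :: "complex ^ 'n ^ 'n"
  assumes sym: "M $ x $ y = M $ y $ x"
    and real: "cnj (M $ x $ y) = M $ x $ y"
begin

lemma bilin_self_adjoint: "bilin (M *v u) v = bilin u (M *v v)"
proof -
  have "bilin (M *v u) v = (\<Sum>x\<in>UNIV. \<Sum>y\<in>UNIV. M $ x $ y * u $ y * v $ x)"
    by (simp add: bilin_def matrix_vector_mult_def sum_distrib_right)
  also have "\<dots> = (\<Sum>y\<in>UNIV. \<Sum>x\<in>UNIV. M $ x $ y * u $ y * v $ x)"
    by (rule sum.swap)
  also have "\<dots> = bilin u (M *v v)"
    by (simp add: bilin_def matrix_vector_mult_def sum_distrib_left mult_ac sym)
  finally show ?thesis .
qed

lemma conj_vec_mult: "conj_vec (M *v v) = M *v conj_vec v"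
  by (simp add: conj_vec_def matrix_vector_mult_def vec_eq_iff real)

lemma eigenvalue_real:
  assumes "M *v v = s *s v" "v \<noteq> 0"
  shows "cnj s = s"
proof -
  have "cnj s * bilin (conj_vec v) v = s * bilin (conj_vec v) v"
    using bilin_self_adjoint[of "conj_vec v" v] assms(1)
    by (simp flip: conj_vec_mult add: conj_vec_simps bilin_simps)
  then show ?thesis
    using assms(2) by (simp add: bilin_conj_vec_eq_0)
qed

lemma eigenvector_orthogonal:
  assumes "M *v u = s *s u" "M *v v = t *s v" "s \<noteq> t"
  shows "bilin u v = 0"
  using bilin_self_adjoint[of u v] assms by (simp add: bilin_simps)

text \<open>This excludes Jordan blocks. The image of M - c is orthogonal to the kernel of M - c,
  which contains \<open>conj_vec w\<close> because \<open>c\<close> is real; so \<open>w\<close> is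
  orthogonal to its own conjugate.\<close>

lemma no_generalized_eigenvector:
  assumes u: "M *v u - c *s u = w" and w: "M *v w = c *s w"
  shows "w = 0"
proof (rule ccontr)
  assume "w \<noteq> 0"
  then have c: "cnj c = c" using w by (rule eigenvalue_real[rotated])
  have "M *v conj_vec w = c *s conj_vec w"
    using w c by (simp flip: conj_vec_mult add: conj_vec_simps)
  then have "bilin (conj_vec w) (M *v u) = c * bilin (conj_vec w) u"
    by (simp flip: bilin_self_adjoint add: bilin_simps)
  then have "bilin (conj_vec w) w = 0"
    by (simp flip: u add: bilin_simps)
  then show False
    using \<open>w \<noteq> 0\<close> by (simp add: bilin_conj_vec_eq_0)
qed

section \<open>The eigenvectors span the whole space\<close>

definition eigenvectors :: "(complex ^ 'n) set" where
  "eigenvectors = {v. \<exists>t. M *v v = t *s v}"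

text \<open>M - c is invertible on every eigenspace for an eigenvalue other than \<open>c\<close>;
  what it cannot reach inside the span is a \<open>c\<close>-eigenvector.\<close>

lemma span_eigenvectors_shift:
  assumes "w \<in> vec.span eigenvectors"
  shows "\<exists>u\<in>vec.span eigenvectors. \<exists>w'. M *v w' = c *s w' \<and> w = M *v u - c *s u + w'"
  using assms
proof (induction rule: vec.span_induct_alt)
  case base
  show ?case by (rule bexI[of _ 0]) (auto intro: exI[of _ 0] simp: vec.span_zero)
next
  case (step a x y)
  then obtain u w' where u: "u \<in> vec.span eigenvectors" "M *v w' = c *s w'"
      "y = M *v u - c *s u + w'" by blast
  obtain s where s: "M *v x = s *s x" using step by (auto simp: eigenvectors_def)
  show ?case
  proof (cases "s = c")
    case True
    show ?thesis
      using u s True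
      by (intro bexI[of _ u] exI[of _ "w' + a *s x"])
        (simp_all add: matrix_vector_right_distrib vector_scalar_commute vector_smult_assoc
          vector_add_ldistrib mult.commute)
  next
    case False
    \<comment> \<open>With this \<open>d\<close> the vector \<open>d *s x\<close> is a preimage of
      \<open>a *s x\<close> under M - c.\<close>
    define d where "d = a / (s - c)"
    have a: "a = d * (s - c)" using False by (simp add: d_def)
    have "d *s (s *s x) - c *s (d *s x) = a *s x"
      unfolding a by (simp add: vec_eq_iff algebra_simps)
    moreover have "u + d *s x \<in> vec.span eigenvectors"
      by (rule vec.span_add[OF u(1) vec.span_scale[OF vec.span_base[OF step(1)]]])
    ultimately show ?thesis
      using u s
      by (intro bexI[of _ "u + d *s x"] exI[of _ w'])
        (simp_all add: matrix_vector_right_distrib vector_scalar_commute vector_add_ldistrib)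
  qed
qed

text \<open>Induction on the degree. For a root \<open>c\<close> of \<open>p\<close>, the quotient
  annihilates (M - c) v, which therefore lies in the span and equals (M - c) u + w with
  \<open>u\<close> in the span and \<open>w\<close> a \<open>c\<close>-eigenvector. Then (M - c)(v -
  u) = w forces w = 0, so v - u is an eigenvector.\<close>

lemma annihilated_in_span_eigenvectors:
  assumes "p \<noteq> 0" "poly_matrix_act M p v = 0"
  shows "v \<in> vec.span eigenvectors"
  using assms
proof (induction "degree p" arbitrary: p v)
  case 0
  then obtain a where "p = [:a:]" by (metis degree_eq_zeroE)
  with 0 show ?case by (simp add: vec.span_zero)
next
  case (Suc n)
  then obtain c where "poly p c = 0"
    using alg_closed_imp_poly_has_root[of p] by auto
  then obtain q where p: "p = [:- c, 1:] * q"
    by (auto simp: poly_eq_0_iff_dvd elim: dvdE)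
  have "q \<noteq> 0" using p Suc.prems by auto
  moreover have "n = degree q"
    using Suc.hyps(2) \<open>q \<noteq> 0\<close> unfolding p by (subst (asm) degree_mult_eq) auto
  moreover have "poly_matrix_act M q (M *v v - c *s v) = 0"
    using Suc.prems p by (simp only: poly_matrix_act_linear_factor)
  ultimately have "M *v v - c *s v \<in> vec.span eigenvectors"
    by (intro Suc.hyps(1)) auto
  then obtain u w where u: "u \<in> vec.span eigenvectors" and w: "M *v w = c *s w"
    and eq: "M *v v - c *s v = M *v u - c *s u + w"
    using span_eigenvectors_shift[of _ c] by blast
  have "M *v (v - u) - c *s (v - u) = w"
    using eq by (simp add: matrix_vector_mult_diff_distrib vector_ssub_ldistrib algebra_simps)
  moreover from this w have "w = 0" by (rule no_generalized_eigenvector)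
  ultimately have "v - u \<in> eigenvectors"
    by (auto simp: eigenvectors_def)
  then have "(v - u) + u \<in> vec.span eigenvectors"
    using u by (rule vec.span_add[OF vec.span_base])
  then show ?case by simp
qed

lemma span_eigenvectors: "v \<in> vec.span eigenvectors"
  using exists_annihilating_poly[of M v] annihilated_in_span_eigenvectors by blast

text \<open>The form in which diagonalizability is used below: a property compatible with linear
  combinations only has to be checked on eigenvectors.\<close>

lemma eigenvector_induct [case_names zero step]:
  assumes "P 0" and "\<And>s a x y. M *v x = s *s x \<Longrightarrow> P y \<Longrightarrow> P (a *s x + y)"
  shows "P v"
  using span_eigenvectors[of v]
  by (induction rule: vec.span_induct_alt) (auto simp: eigenvectors_def intro: assms)

lemma matrix_eqI_eigenvectors:
  assumes "\<And>s v. M *v v = s *s v \<Longrightarrow> P *v v = Q *v v"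
  shows "P = Q"
proof -
  have "P *v v = Q *v v" for v
    by (induction v rule: eigenvector_induct)
      (auto dest: assms simp: matrix_vector_right_distrib vector_scalar_commute)
  then show ?thesis by (simp add: matrix_eq)
qed

text \<open>Pair an s-eigenvector v with \<open>p(M)\<close> applied to the basis vector at x, where
  \<open>p\<close> annihilates that basis vector. Self-adjointness gives p(s) v_x = 0, so s is a
  root of one of finitely many polynomials.\<close>

lemma finite_eigenvalues: "finite {s. \<exists>v. v \<noteq> 0 \<and> M *v v = s *s v}"
proof -
  have "\<forall>x. \<exists>p. p \<noteq> 0 \<and> poly_matrix_act M p (axis x 1) = 0"
    using exists_annihilating_poly by blast
  then obtain p where p: "p x \<noteq> 0" "poly_matrix_act M (p x) (axis x 1) = 0" for x
    by metis
  have bilin_act: "bilin v (poly_matrix_act M q u) = poly q s * bilin v u"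
    if "M *v v = s *s v" for q s u v
    by (induction q) (simp_all add: that bilin_simps algebra_simps flip: bilin_self_adjoint)
  have "{s. \<exists>v. v \<noteq> 0 \<and> M *v v = s *s v} \<subseteq> (\<Union>x. {s. poly (p x) s = 0})"
  proof clarify
    fix s and v :: "complex ^ 'n"
    assume v: "v \<noteq> 0" "M *v v = s *s v"
    then obtain x where x: "v $ x \<noteq> 0" by (auto simp: vec_eq_iff)
    have "poly (p x) s * v $ x = 0"
      using bilin_act[OF v(2), of "p x" "axis x 1"] p by (simp add: bilin_axis bilin_simps)
    with x show "s \<in> (\<Union>x. {s. poly (p x) s = 0})" by auto
  qed
  moreover have "finite (\<Union>x. {s. poly (p x) s = 0})"
    using p by (intro finite_UN_I) (auto simp: poly_roots_finite)
  ultimately show ?thesis by (rule finite_subset)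
qed

text \<open>The matrix is q(M), built by the Horner scheme; its effect on eigenvectors is all that
  is needed of it.\<close>

lemma exists_poly_matrix: "\<exists>K. \<forall>s v. M *v v = s *s v \<longrightarrow> K *v v = poly q s *s v"
proof (induction q)
  case 0
  show ?case by (rule exI[of _ 0]) simp
next
  case (pCons a q)
  then obtain K where K: "\<And>s v. M *v v = s *s v \<Longrightarrow> K *v v = poly q s *s v" by blast
  have "(mat a + M ** K) *v v = poly (pCons a q) s *s v" if "M *v v = s *s v" for s v
    using that K[OF that]
    by (simp add: mat_mult_vector matrix_vector_mult_add_rdistrib vector_scalar_commute
        vector_sadd_rdistrib vector_smult_assoc mult.commute flip: matrix_vector_mul_assoc)
  then show ?case by blast
qed

lemma exists_primitive_idempotent:
  assumes "v \<noteq> 0" "M *v v = t *s v"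
  shows "\<exists>P. primitive_idempotent M P \<and> P *v v = v"
proof -
  let ?S = "{s. \<exists>v. v \<noteq> 0 \<and> M *v v = s *s v}"
  \<comment> \<open>The Lagrange interpolation polynomial: 1 at \<open>t\<close> and 0 at all other
    eigenvalues.\<close>
  define q where "q = (\<Prod>s\<in>?S - {t}. Polynomial.smult (1 / (t - s)) [:- s, 1:])"
  have q: "poly q s = (\<Prod>s'\<in>?S - {t}. 1 / (t - s') * (s - s'))" for s
    by (simp add: q_def poly_prod diff_divide_distrib)
  have qt: "poly q t = 1"
    unfolding q by (rule prod.neutral) auto
  have qs: "poly q s = 0" if "s \<in> ?S" "s \<noteq> t" for s
    unfolding q using that finite_eigenvalues by (subst prod_zero_iff) auto
  obtain K where K: "\<And>s v. M *v v = s *s v \<Longrightarrow> K *v v = poly q s *s v"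
    using exists_poly_matrix by blast
  have 1: "K *v u = u" if "M *v u = t *s u" for u
    using K[OF that] qt by simp
  moreover have "K *v u = 0" if "s \<noteq> t" "M *v u = s *s u" for s u
    using K[OF that(2)] qs[of s] that by (cases "u = 0") auto
  ultimately have "primitive_idempotent M K"
    unfolding primitive_idempotent_def using assms by (intro exI[of _ t]) blast
  then show ?thesis using 1 assms(2) by blast
qed

end

section \<open>Primitive idempotents and Krein parameters\<close>

lemma sum_swap_pairs:
  "(\<Sum>x\<in>A. \<Sum>y\<in>B. \<Sum>w\<in>C. \<Sum>v\<in>D. f x y w v) =
    (\<Sum>w\<in>C. \<Sum>v\<in>D. \<Sum>x\<in>A. \<Sum>y\<in>B. f x y w v)"
proof -
  have "(\<Sum>x\<in>A. \<Sum>y\<in>B. \<Sum>w\<in>C. \<Sum>v\<in>D. f x y w v) = (\<Sum>x\<in>A. \<Sum>w\<in>C. \<Sum>y\<in>B. \<Sum>v\<in>D. f x y w v)"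
    by (rule sum.cong[OF refl], rule sum.swap)
  also have "\<dots> = (\<Sum>w\<in>C. \<Sum>x\<in>A. \<Sum>y\<in>B. \<Sum>v\<in>D. f x y w v)"
    by (rule sum.swap)
  also have "\<dots> = (\<Sum>w\<in>C. \<Sum>x\<in>A. \<Sum>v\<in>D. \<Sum>y\<in>B. f x y w v)"
    by (rule sum.cong[OF refl], rule sum.cong[OF refl], rule sum.swap)
  also have "\<dots> = (\<Sum>w\<in>C. \<Sum>v\<in>D. \<Sum>x\<in>A. \<Sum>y\<in>B. f x y w v)"
    by (rule sum.cong[OF refl], rule sum.swap)
  finally show ?thesis .
qed

locale spectral_decomposition = real_symmetric_matrix M
  for M :: "complex ^ 'n ^ 'n" +
  fixes D :: nat and E :: "nat \<Rightarrow> complex ^ 'n ^ 'n" and \<theta> :: "nat \<Rightarrow> complex"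
  assumes bij: "bij_betw E {0..D} {P. primitive_idempotent M P}"
    and eigen: "i \<le> D \<Longrightarrow> M ** E i = mat (\<theta> i) ** E i"
begin

lemma mult_E: "i \<le> D \<Longrightarrow> M *v (E i *v v) = \<theta> i *s (E i *v v)"
  using eigen[of i] by (simp add: matrix_vector_mul_assoc flip: mat_mult_vector)

text \<open>The eigenvalue hidden in \<open>primitive_idempotent\<close> is identified with
  \<open>\<theta> i\<close>: a nonzero vector of that eigenspace is fixed by \<open>E i\<close>,
  while M scales everything in the image of \<open>E i\<close> by \<open>\<theta> i\<close>.\<close>

lemma E_primitive:
  assumes "i \<le> D"
  shows "\<exists>v. v \<noteq> 0 \<and> M *v v = \<theta> i *s v"
    and "M *v v = \<theta> i *s v \<Longrightarrow> E i *v v = v"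
    and "s \<noteq> \<theta> i \<Longrightarrow> M *v v = s *s v \<Longrightarrow> E i *v v = 0"
proof -
  have "primitive_idempotent M (E i)"
    using bij assms by (auto simp: bij_betw_def)
  then obtain t u where u: "u \<noteq> 0" "M *v u = t *s u"
    and on: "\<And>v. M *v v = t *s v \<Longrightarrow> E i *v v = v"
    and off: "\<And>s v. s \<noteq> t \<Longrightarrow> M *v v = s *s v \<Longrightarrow> E i *v v = 0"
    unfolding primitive_idempotent_def by blast
  have "\<theta> i *s u = t *s u"
    using mult_E[OF assms, of u] u on[of u] by simp
  then have t: "t = \<theta> i" using u by simp
  show "\<exists>v. v \<noteq> 0 \<and> M *v v = \<theta> i *s v"
    and "M *v v = \<theta> i *s v \<Longrightarrow> E i *v v = v"
    and "s \<noteq> \<theta> i \<Longrightarrow> M *v v = s *s v \<Longrightarrow> E i *v v = 0"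
    using u on off by (auto simp: t)
qed

lemma E_mult:
  assumes "i \<le> D"
  shows "E i *v (M *v v) = \<theta> i *s (E i *v v)"
proof (induction v rule: eigenvector_induct)
  case (step s a x y)
  have "E i *v (M *v x) = \<theta> i *s (E i *v x)"
    using E_primitive(3)[OF assms _ step(1)] step(1)
    by (cases "s = \<theta> i") (simp_all add: vector_scalar_commute)
  then show ?case
    using step(2) by (simp add: matrix_vector_right_distrib vector_scalar_commute
        vector_add_ldistrib vector_smult_assoc mult.commute)
qed simp

text \<open>A primitive idempotent is determined by its eigenvalue, since its effect on every
  eigenvector is; the enumeration is injective.\<close>

lemma eigenvalues_distinct:
  assumes "i \<le> D" "j \<le> D" "\<theta> i = \<theta> j"
  shows "i = j"
proof -
  have "E i = E j"
  proof (rule matrix_eqI_eigenvectors)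
    fix s v
    assume v: "M *v v = s *s v"
    show "E i *v v = E j *v v"
      using E_primitive(2,3)[OF assms(1)] E_primitive(2,3)[OF assms(2)] v assms(3)
      by (cases "s = \<theta> j") auto
  qed
  then show ?thesis
    using bij assms(1,2) by (auto simp: bij_betw_def inj_on_def)
qed

text \<open>Completeness of the list: every eigenvalue has a primitive idempotent, and the
  enumeration reaches all of them.\<close>

lemma eigenvalue_listed:
  assumes "v \<noteq> 0" "M *v v = s *s v"
  obtains i where "i \<le> D" "s = \<theta> i"
proof -
  obtain P where P: "primitive_idempotent M P" "P *v v = v"
    using exists_primitive_idempotent[OF assms] by blast
  then obtain i where i: "i \<le> D" "P = E i"
    using bij by (force simp: bij_betw_def)
  moreover have "s = \<theta> i"
    using E_primitive(3)[OF i(1) _ assms(2)] P i assms(1) by auto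
  ultimately show ?thesis using that by blast
qed

section \<open>Orthogonality, completeness, symmetry and reality of the idempotents\<close>

lemma E_orthogonal:
  assumes "i \<le> D" "j \<le> D"
  shows "E i *v (E j *v v) = (if i = j then E i *v v else 0)"
  using E_primitive(2)[OF assms(1), of "E j *v v"] E_primitive(3)[OF assms(1), of "\<theta> j" "E j *v v"]
    mult_E[OF assms(2)] eigenvalues_distinct[OF assms(2,1)] by auto

lemma sum_E: "(\<Sum>i\<le>D. E i *v v) = v"
proof (induction v rule: eigenvector_induct)
  case zero
  show ?case by simp
next
  case (step s a x y)
  have "(\<Sum>i\<le>D. E i *v x) = x"
  proof (cases "x = 0")
    case False
    then obtain k where k: "k \<le> D" "s = \<theta> k"
      using step(1) by (rule eigenvalue_listed)
    have "E i *v x = (if i = k then x else 0)" if "i \<le> D" for i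
      using E_primitive(2)[OF that, of x] E_primitive(3)[OF that, of "\<theta> k" x] step(1) k
        eigenvalues_distinct[OF k(1) that] by auto
    then show ?thesis using k by simp
  qed simp
  then show ?case
    using step(2) by (simp add: matrix_vector_right_distrib vector_scalar_commute sum.distrib
        flip: vec.scale_sum_right)
qed

lemma eqI_E:
  assumes "\<And>i. i \<le> D \<Longrightarrow> E i *v u = E i *v v"
  shows "u = v"
proof -
  have "(\<Sum>i\<le>D. E i *v u) = (\<Sum>i\<le>D. E i *v v)"
    by (rule sum.cong) (auto simp: assms)
  then show ?thesis by (simp add: sum_E)
qed

text \<open>By linearity in both arguments it suffices to take two eigenvectors. If
  \<open>E i\<close> fixes one and kills the other, their eigenvalues differ and the vectors are
  orthogonal; otherwise both sides agree at once.\<close>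

lemma bilin_E:
  assumes "i \<le> D"
  shows "bilin (E i *v u) v = bilin u (E i *v v)"
proof (induction u rule: eigenvector_induct)
  case zero
  show ?case by (simp add: bilin_simps)
next
  case (step s a x y)
  have "bilin (E i *v x) v = bilin x (E i *v v)"
  proof (induction v rule: eigenvector_induct)
    case zero
    show ?case by (simp add: bilin_simps)
  next
    case (step t b z w)
    have "bilin (E i *v x) z = bilin x (E i *v z)"
      using E_primitive(2)[OF assms, of x] E_primitive(3)[OF assms, of _ x]
        E_primitive(2)[OF assms, of z] E_primitive(3)[OF assms, of _ z]
        eigenvector_orthogonal[OF \<open>M *v x = s *s x\<close> step(1)] step(1) \<open>M *v x = s *s x\<close>
      by (cases "s = \<theta> i"; cases "t = \<theta> i") (auto simp: bilin_simps)
    then show ?case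
      using step(2) by (simp add: bilin_simps matrix_vector_right_distrib vector_scalar_commute)
  qed
  then show ?case
    using step(2) by (simp add: bilin_simps matrix_vector_right_distrib vector_scalar_commute)
qed

lemma E_entry: "E i $ x $ y = (E i *v axis y 1) $ x"
  by (simp add: matrix_vector_mult_def axis_def if_distrib cong: if_cong)

lemma E_sym: "i \<le> D \<Longrightarrow> E i $ x $ y = E i $ y $ x"
  using bilin_E[of i "axis y 1" "axis x 1"] by (simp add: bilin_axis E_entry)

text \<open>Eigenvalues of M are real, so conjugation maps each eigenspace to itself.\<close>

lemma conj_E:
  assumes "i \<le> D"
  shows "conj_vec (E i *v v) = E i *v conj_vec v"
proof (induction v rule: eigenvector_induct)
  case zero
  show ?case by (simp add: conj_vec_simps)
next
  case (step s a x y)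
  have "cnj (\<theta> i) = \<theta> i"
    using E_primitive(1)[OF assms] eigenvalue_real by blast
  then have eq: "cnj s = \<theta> i \<longleftrightarrow> s = \<theta> i" by (metis complex_cnj_cnj)
  have "M *v conj_vec x = cnj s *s conj_vec x"
    using step(1) by (simp flip: conj_vec_mult add: conj_vec_simps)
  then have "conj_vec (E i *v x) = E i *v conj_vec x"
    using E_primitive(2)[OF assms, of x] E_primitive(3)[OF assms, of _ x]
      E_primitive(2)[OF assms, of "conj_vec x"] E_primitive(3)[OF assms, of _ "conj_vec x"]
      step(1) eq
    by (cases "s = \<theta> i") (auto simp: conj_vec_simps)
  then show ?case
    using step(2) by (simp add: conj_vec_simps matrix_vector_right_distrib vector_scalar_commute)
qed

lemma E_real:
  assumes "i \<le> D"
  shows "cnj (E i $ x $ y) = E i $ x $ y"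
proof -
  have "conj_vec (axis y 1) = axis y (1 :: complex)"
    by (simp add: conj_vec_def axis_def vec_eq_iff)
  then show ?thesis
    using conj_E[OF assms, of "axis y 1"] by (simp add: E_entry) (simp add: conj_vec_def vec_eq_iff)
qed

lemma E_product_entry:
  assumes "i \<le> D" "j \<le> D"
  shows "(\<Sum>w\<in>UNIV. E i $ x $ w * E j $ w $ y) = (if i = j then E i $ x $ y else 0)"
proof -
  have "(\<Sum>w\<in>UNIV. E i $ x $ w * E j $ w $ y) = (E i *v (E j *v axis y 1)) $ x"
    by (simp add: matrix_vector_mult_def[of "E i"] E_entry[symmetric])
  then show ?thesis
    by (simp add: E_orthogonal[OF assms] E_entry)
qed

text \<open>With $W = E_i\, \mathrm{diag}(E_h(z, \cdot))\, E_j$, the sum of the squares of the (real)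
  entries of $W$ equals $|X|^{-1} q^h_{ij} E_h(z, z)$.\<close>

lemma triple_product_zero:
  assumes krein: "krein_parameters D E q" and ij: "i \<le> D" "j \<le> D" and "h \<le> D"
    and "q h i j = 0"
  shows "(\<Sum>w\<in>UNIV. E i $ x $ w * E h $ z $ w * E j $ w $ y) = 0"
proof -
  define W where "W x y = (\<Sum>w\<in>UNIV. E i $ x $ w * E h $ z $ w * E j $ w $ y)" for x y
  have real: "cnj (W x y) = W x y" for x y
    using assms by (simp add: W_def E_real)
  \<comment> \<open>By symmetry of \<open>E i\<close> and \<open>E j\<close>, expanding the squares
    makes \<open>x\<close> and \<open>y\<close> inner indices of matrix products.\<close>
  have "(\<Sum>x\<in>UNIV. \<Sum>y\<in>UNIV. W x y * W x y) =
      (\<Sum>x\<in>UNIV. \<Sum>y\<in>UNIV. \<Sum>w\<in>UNIV. \<Sum>w'\<in>UNIV. E h $ z $ w * E h $ z $ w' *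
        ((E i $ w $ x * E i $ x $ w') * (E j $ w $ y * E j $ y $ w')))"
    using E_sym[OF ij(1)] E_sym[OF ij(2)]
    by (simp add: W_def sum_product mult_ac)
  also have "\<dots> = (\<Sum>w\<in>UNIV. \<Sum>w'\<in>UNIV. \<Sum>x\<in>UNIV. \<Sum>y\<in>UNIV. E h $ z $ w * E h $ z $ w' *
        ((E i $ w $ x * E i $ x $ w') * (E j $ w $ y * E j $ y $ w')))"
    by (rule sum_swap_pairs)
  also have "\<dots> = (\<Sum>w\<in>UNIV. \<Sum>w'\<in>UNIV. E h $ z $ w * E h $ z $ w' *
        ((\<Sum>x\<in>UNIV. E i $ w $ x * E i $ x $ w') * (\<Sum>y\<in>UNIV. E j $ w $ y * E j $ y $ w')))"
    by (simp only: sum_product) (simp only: sum_distrib_left)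
  \<comment> \<open>Idempotence of \<open>E i\<close> and \<open>E j\<close> removes the sums over
    \<open>x\<close> and \<open>y\<close>. What remains is their entrywise product, which the Krein
    parameters expand.\<close>
  also have "\<dots> = (\<Sum>w\<in>UNIV. \<Sum>w'\<in>UNIV. E h $ z $ w * E h $ z $ w' *
        (E i $ w $ w' * E j $ w $ w'))"
    by (simp add: E_product_entry ij)
  also have "\<dots> = (\<Sum>w\<in>UNIV. \<Sum>w'\<in>UNIV. \<Sum>k\<le>D. q k i j / of_nat CARD('n) *
        (E h $ z $ w * (E k $ w $ w' * E h $ w' $ z)))"
    using krein ij E_sym[OF \<open>h \<le> D\<close>, of z]
    by (simp add: krein_parameters_def sum_distrib_left sum_divide_distrib mult_ac)
  also have "\<dots> = (\<Sum>k\<le>D. \<Sum>w\<in>UNIV. \<Sum>w'\<in>UNIV. q k i j / of_nat CARD('n) *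
        (E h $ z $ w * (E k $ w $ w' * E h $ w' $ z)))"
    by (rule trans[OF sum.cong[OF refl sum.swap] sum.swap])
  also have "\<dots> = (\<Sum>k\<le>D. q k i j / of_nat CARD('n) * (\<Sum>w\<in>UNIV. E h $ z $ w *
        (\<Sum>w'\<in>UNIV. E k $ w $ w' * E h $ w' $ z)))"
    by (simp only: sum_distrib_left)
  also have "\<dots> = 0"
  \<comment> \<open>For k \<noteq> h the inner sum is an entry of the zero matrix
    \<open>E k ** E h\<close>; for k = h the coefficient \<open>q h i j\<close> is zero.\<close>
  proof (intro sum.neutral ballI)
    fix k
    assume "k \<in> {..D}"
    then show "q k i j / of_nat CARD('n) *
        (\<Sum>w\<in>UNIV. E h $ z $ w * (\<Sum>w'\<in>UNIV. E k $ w $ w' * E h $ w' $ z)) = 0"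
      using assms by (cases "k = h") (simp_all add: E_product_entry)
  qed
  finally have "(\<Sum>x\<in>UNIV. \<Sum>y\<in>UNIV. W x y * W x y) = 0" .
  moreover have "W x y * W x y = of_real ((cmod (W x y))\<^sup>2)" for x y
    using complex_norm_square[of "W x y"] by (simp add: real)
  ultimately have "of_real (\<Sum>x\<in>UNIV. \<Sum>y\<in>UNIV. (cmod (W x y))\<^sup>2) = (0 :: complex)"
    by (simp del: of_real_power)
  then have "(\<Sum>x\<in>UNIV. \<Sum>y\<in>UNIV. (cmod (W x y))\<^sup>2) = 0"
    by (simp only: of_real_eq_0_iff)
  then have "W x y = 0"
    by (simp add: sum_nonneg_eq_0_iff sum_nonneg)
  then show ?thesis by (simp add: W_def)
qed

end

section \<open>Modules for presented algebras\<close>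

lemma poly_mapping_single_induct [case_names zero single_plus]:
  assumes "P 0" and "\<And>k c p. P p \<Longrightarrow> P (Poly_Mapping.single k c + p)"
  shows "P (p :: 'a \<Rightarrow>\<^sub>0 'b::comm_monoid_add)"
proof (induction p rule: update_induct)
  case const
  show ?case by (rule assms(1))
next
  case (update f a b)
  \<comment> \<open>The key \<open>a\<close> is new to \<open>f\<close>, so the update is the
    addition of a monomial.\<close>
  have "Poly_Mapping.update a b f = Poly_Mapping.single a b + f"
    using update(1) by (intro poly_mapping_eqI)
      (auto simp: lookup_update lookup_add lookup_single when_def in_keys_iff)
  then show ?case using assms(2) update by simp
qed

locale generator_action = vector_space scl
  for scl :: "'f::field \<Rightarrow> 'w::ab_group_add \<Rightarrow> 'w" +
  fixes G :: "'g \<Rightarrow> 'w \<Rightarrow> 'w"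
  assumes linear_G: "Vector_Spaces.linear scl scl (G g)"
begin

text \<open>\<open>foldr\<close> lets the last letter act first, so concatenation of words becomes
  composition of operators and the action is a left action.\<close>

definition eval :: "('g, 'f) free_algebra \<Rightarrow> 'w \<Rightarrow> 'w" where
  "eval p w = (\<Sum>k\<in>Poly_Mapping.keys p. scl (Poly_Mapping.lookup p k) (foldr G (letters k) w))"

lemma eval_superset:
  assumes "finite K" "Poly_Mapping.keys p \<subseteq> K"
  shows "eval p w = (\<Sum>k\<in>K. scl (Poly_Mapping.lookup p k) (foldr G (letters k) w))"
  unfolding eval_def using assms
  by (intro sum.mono_neutral_left) (auto simp: in_keys_iff)

lemma eval_0 [simp]: "eval 0 w = 0"
  by (simp add: eval_def)

lemma eval_add [simp]: "eval (p + q) w = eval p w + eval q w"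
proof -
  let ?K = "Poly_Mapping.keys p \<union> Poly_Mapping.keys q"
  have "Poly_Mapping.keys (p + q) \<subseteq> ?K" by (rule keys_add)
  then show ?thesis
    by (simp add: eval_superset[of ?K] lookup_add scale_left_distrib sum.distrib)
qed

lemma eval_single: "eval (Poly_Mapping.single k c) w = scl c (foldr G (letters k) w)"
  using eval_superset[of "{k}" "Poly_Mapping.single k c" w] by (simp split: if_splits)

lemma eval_gen [simp]: "eval (free_gen g) w = G g w"
  by (simp add: free_gen_def eval_single)

lemma eval_const [simp]: "eval (free_const c) w = scl c w"
  by (simp add: free_const_def eval_single zero_free_word_def)

lemma eval_one [simp]: "eval 1 w = w"
  using eval_const[of 1 w] by (simp add: free_const_def)

lemma eval_uminus [simp]: "eval (- p) w = - eval p w"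
  using eval_add[of p "- p" w] by (simp add: eq_neg_iff_add_eq_0 add.commute)

lemma eval_diff [simp]: "eval (p - q) w = eval p w - eval q w"
  using eval_add[of "p - q" q w] by simp

lemma linear_eval: "Vector_Spaces.linear scl scl (eval p)"
proof -
  interpret pair: vector_space_pair scl scl ..
  have foldr: "Vector_Spaces.linear scl scl (foldr G ls)" for ls
  proof (induction ls)
    case Nil
    show ?case using linear_id by (simp add: id_def)
  next
    case (Cons g ls)
    then show ?case
      using Vector_Spaces.linear_compose[OF Cons linear_G] by (simp add: o_def)
  qed
  show ?thesis
    unfolding eval_def
    by (intro pair.linear_compose_sum ballI pair.linear_compose_scale_right foldr)
qed

text \<open>Both sides are additive in \<open>p\<close> and in \<open>q\<close>, which leaves two
  scaled words; there the scalar of the second word passes through the linear action of the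
  first.\<close>

lemma eval_mult [simp]: "eval (p * q) w = eval p (eval q w)"
proof (induction p rule: poly_mapping_single_induct)
  case (single_plus k c p)
  interpret lin: Vector_Spaces.linear scl scl "eval (Poly_Mapping.single k c)"
    by (rule linear_eval)
  have "eval (Poly_Mapping.single k c * q) w = eval (Poly_Mapping.single k c) (eval q w)"
  proof (induction q rule: poly_mapping_single_induct)
    case (single_plus l d q)
    interpret f: Vector_Spaces.linear scl scl "foldr G (letters k)"
      using linear_eval[of "Poly_Mapping.single k 1"] by (simp add: eval_single[abs_def])
    have "eval (Poly_Mapping.single k c * Poly_Mapping.single l d) w =
        eval (Poly_Mapping.single k c) (eval (Poly_Mapping.single l d) w)"
      by (simp add: mult_single eval_single plus_free_word_def f.scale)
    then show ?case
      using single_plus by (simp add: distrib_left lin.add)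
  qed (simp add: lin.zero)
  then show ?case
    using single_plus by (simp add: distrib_right)
qed simp

text \<open>The relators lie in the ideal of elements acting as zero, so the action factors through the
  quotient; a coset acts through any of its representatives.\<close>

lemma presented_algebra_module:
  assumes rel: "\<And>r w. r \<in> S \<Longrightarrow> eval r w = 0"
  shows "\<exists>act. left_algebra_module (presented_algebra S) scl act \<and>
    (\<forall>g. act (presented_class S (free_gen g)) = G g)"
proof -
  let ?F = "free_algebra_ring :: ('g, 'f) free_algebra ring"
  let ?I = "genideal ?F S"
  let ?N = "{p. \<forall>w. eval p w = 0}"
  interpret pair: vector_space_pair scl scl ..
  interpret F: ring ?F by (rule ring_free_algebra_ring)
  interpret I: ideal ?I ?F
    by (rule F.genideal_ideal) (simp add: free_algebra_ring_def)
  have minus_F: "a \<ominus>\<^bsub>?F\<^esub> b = a - b" for a b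
  proof -
    have "\<ominus>\<^bsub>?F\<^esub> b = - b"
      by (rule F.minus_equality) (simp_all add: free_algebra_ring_def)
    then show ?thesis
      by (simp add: a_minus_def free_algebra_ring_def)
  qed
  have "ideal ?N ?F"
  proof (rule idealI)
    show "ring ?F" by (rule ring_free_algebra_ring)
    have "\<ominus>\<^bsub>?F\<^esub> b = - b" for b
      by (rule F.minus_equality) (simp_all add: free_algebra_ring_def)
    then show "subgroup ?N (add_monoid ?F)"
      by (intro F.add.subgroupI) (auto simp: free_algebra_ring_def a_inv_def intro: exI[of _ 0])
  next
    fix a x assume "a \<in> ?N"
    \<comment> \<open>Closure under left multiplication uses that \<open>eval x\<close> is linear
      and so maps 0 to 0.\<close>
    then show "x \<otimes>\<^bsub>?F\<^esub> a \<in> ?N" "a \<otimes>\<^bsub>?F\<^esub> x \<in> ?N"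
      using pair.linear_0[OF linear_eval] by (auto simp: free_algebra_ring_def)
  qed
  then have IN: "?I \<subseteq> ?N"
    by (rule F.genideal_minimal) (use rel in auto)
  define act where "act t = eval (SOME p. t = presented_class S p)" for t
  have act: "act (presented_class S p) = eval p" for p
  proof -
    define p' where "p' = (SOME p'. presented_class S p = presented_class S p')"
    have "presented_class S p = presented_class S p'"
      unfolding p'_def by (rule someI) (rule refl)
    then have "p - p' \<in> ?I"
      using F.quotient_eq_iff_same_a_r_cos[OF I.ideal_axioms, of p p']
      by (simp add: presented_class_def minus_F) (simp add: free_algebra_ring_def)
    then have "eval p w = eval p' w" for w
      using IN by (auto dest: subsetD)
    then show ?thesis by (simp add: act_def p'_def fun_eq_iff)
  qed
  let ?T = "presented_algebra S"
  have carrier: "carrier ?T = range (presented_class S)"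
  proof -
    have "carrier ?F = UNIV" by (simp add: free_algebra_ring_def)
    then show ?thesis
      by (auto simp: presented_algebra_def Let_def FactRing_def A_RCOSETS_def' presented_class_def)
  qed
  have add: "presented_class S p \<oplus>\<^bsub>?T\<^esub> presented_class S q = presented_class S (p + q)" for p q
    using I.a_rcos_sum[of p q]
    by (simp add: presented_algebra_def Let_def FactRing_def presented_class_def
        free_algebra_ring_def)
  have mult: "presented_class S p \<otimes>\<^bsub>?T\<^esub> presented_class S q = presented_class S (p * q)" for p q
    using I.rcoset_mult_add[of p q]
    by (simp add: presented_algebra_def Let_def FactRing_def presented_class_def
        free_algebra_ring_def)
  have smult: "c \<odot>\<^bsub>?T\<^esub> t = presented_class S (free_const c) \<otimes>\<^bsub>?T\<^esub> t" for c t
    by (simp add: presented_algebra_def Let_def)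
  have one: "\<one>\<^bsub>?T\<^esub> = presented_class S 1"
    by (simp add: presented_algebra_def Let_def FactRing_def presented_class_def
        free_algebra_ring_def)
  have "left_algebra_module ?T scl act"
    unfolding left_algebra_module_def carrier smult one
    using linear_eval vector_space_axioms by (auto simp: act add mult)
  then show ?thesis
    using act by (intro exI[of _ act]) (auto simp: fun_eq_iff)
qed

end

section \<open>Tridiagonal relations\<close>

text \<open>Stated for maps rather than matrices, so that it applies both to operators on the tensor
  space and to the matrices acting on its slices.\<close>

definition tridiagonal_expr ::
    "complex \<Rightarrow> complex \<Rightarrow> complex \<Rightarrow> (complex ^ 'n \<Rightarrow> complex ^ 'n) \<Rightarrow> (complex ^ 'n \<Rightarrow> complex ^ 'n) \<Rightarrow>
      complex ^ 'n \<Rightarrow> complex ^ 'n" where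
  "tridiagonal_expr b g r X Y w =
     X (X (Y w)) - b *s X (Y (X w)) + Y (X (X w)) - g *s (X (Y w) + Y (X w)) - r *s Y w"

definition tridiagonal_relation ::
    "complex \<Rightarrow> complex \<Rightarrow> complex \<Rightarrow> (complex ^ 'n \<Rightarrow> complex ^ 'n) \<Rightarrow> (complex ^ 'n \<Rightarrow> complex ^ 'n) \<Rightarrow> bool"
  where
  "tridiagonal_relation b g r X Y \<longleftrightarrow>
     (\<forall>w. X (tridiagonal_expr b g r X Y w) = tridiagonal_expr b g r X Y (X w))"

text \<open>Between \<open>E i\<close> and \<open>E j\<close> the commutator becomes (\<theta>_i -
  \<theta>_j) P(\<theta>_i, \<theta>_j) E_i N E_j, with P the quadratic polynomial of the
  hypothesis. One of the three factors is always zero.\<close>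

lemma (in spectral_decomposition) tridiagonal_relation_if_triple_products:
  assumes "\<And>i j. i \<le> D \<Longrightarrow> j \<le> D \<Longrightarrow> i \<noteq> j \<Longrightarrow>
    (\<theta> i)\<^sup>2 - b * \<theta> i * \<theta> j + (\<theta> j)\<^sup>2 - g * (\<theta> i + \<theta> j) - r = 0 \<or> (\<forall>v. E i *v (N *v (E j *v v)) = 0)"
  shows "tridiagonal_relation b g r ((*v) M) ((*v) N)"
  unfolding tridiagonal_relation_def
proof (rule allI, rule eqI_E)
  fix w i
  assume i: "i \<le> D"
  define f where "f v = E i *v (N *v v)" for v
  have f_lin: "f (u + v) = f u + f v" "f (a *s v) = a *s f v" "f 0 = 0" for u v a
    by (simp_all add: f_def matrix_vector_right_distrib vector_scalar_commute)
  let ?t = "\<theta> i"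
  \<comment> \<open>\<open>L\<close> is \<open>E i\<close> applied to the tridiagonal expression:
    each M to the left of N meets \<open>E i\<close> and turns into the scalar
    \<open>\<theta> i\<close>.\<close>
  define L where "L v = ?t *s (?t *s f v) - b *s (?t *s f (M *v v)) + f (M *v (M *v v))
      - g *s (?t *s f v + f (M *v v)) - r *s f v" for v
  have E_expr: "E i *v tridiagonal_expr b g r ((*v) M) ((*v) N) v = L v" for v
    by (simp add: tridiagonal_expr_def L_def f_def matrix_vector_right_distrib
        matrix_vector_mult_diff_distrib vector_scalar_commute E_mult[OF i])
  have "?t *s L w = L (M *v w)"
  proof (induction w rule: eigenvector_induct)
    case zero
    show ?case by (simp add: L_def f_lin)
  next
    case (step s a x y)
    have "?t *s L x = L (M *v x)"
    \<comment> \<open>The zero vector satisfies the eigenvector equation for every \<open>s\<close>,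
      so \<open>s\<close> is a listed eigenvalue only if \<open>x\<close> is nonzero.\<close>
    proof (cases "x = 0")
      case False
      then obtain j where j: "j \<le> D" "s = \<theta> j"
        using step(1) by (rule eigenvalue_listed)
      have Lx: "L x = (?t\<^sup>2 - b * ?t * s + s\<^sup>2 - g * (?t + s) - r) *s f x"
        by (simp add: L_def step(1) vector_scalar_commute f_lin vec_eq_iff power2_eq_square
            algebra_simps)
      have "?t = s \<or> ?t\<^sup>2 - b * ?t * s + s\<^sup>2 - g * (?t + s) - r = 0 \<or> f x = 0"
        using assms[OF i j(1)] E_primitive(2)[OF j(1), of x] step(1) j(2)
        unfolding f_def by metis
      then have "?t = s \<or> L x = 0"
        unfolding Lx by (elim disjE) simp_all
      moreover have "L (M *v x) = s *s L x"
        by (simp add: L_def step(1) vector_scalar_commute f_lin vec_eq_iff algebra_simps)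
      ultimately show ?thesis by auto
    qed (simp add: L_def f_lin)
    moreover have "L (a *s u + v) = a *s L u + L v" for u v
      by (simp add: L_def matrix_vector_right_distrib vector_scalar_commute f_lin vec_eq_iff
          algebra_simps)
    ultimately show ?case
      using step(2) by (simp add: matrix_vector_right_distrib vector_scalar_commute
          vector_add_ldistrib vector_smult_assoc mult.commute[of ?t a] flip: vector_smult_assoc)
  qed
  then show "E i *v (M *v tridiagonal_expr b g r ((*v) M) ((*v) N) w) =
      E i *v tridiagonal_expr b g r ((*v) M) ((*v) N) (M *v w)"
    by (simp add: E_mult[OF i] E_expr)
qed

definition diag_matrix :: "('n \<Rightarrow> complex) \<Rightarrow> complex ^ 'n ^ 'n" where
  "diag_matrix d = (\<chi> x y. if x = y then d x else 0)"

lemma diag_matrix_mult: "(diag_matrix d *v v) $ x = d x * v $ x"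
  by (simp add: diag_matrix_def matrix_vector_mult_def if_distrib[of "\<lambda>a. a * _"] cong: if_cong)

text \<open>Neighbouring indices are handled by the quadratic relation \<open>near\<close>, all more
  distant ones by the vanishing triple products. For h = 1 and c = |X| the diagonal matrix is the
  dual adjacency matrix with base vertex \<open>z\<close>.\<close>

lemma (in spectral_decomposition) tridiagonal_relation_idempotent_row:
  assumes krein: "krein_parameters D E q" and h: "h \<le> D"
    and far: "\<And>i j. i \<le> D \<Longrightarrow> j \<le> D \<Longrightarrow> i > 1 + j \<or> j > 1 + i \<Longrightarrow> q h i j = 0"
    and near: "\<And>i. i < D \<Longrightarrow>
      (\<theta> i)\<^sup>2 - b * \<theta> i * \<theta> (i + 1) + (\<theta> (i + 1))\<^sup>2 - g * (\<theta> i + \<theta> (i + 1)) - r = 0"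
  shows "tridiagonal_relation b g r ((*v) M) ((*v) (diag_matrix (\<lambda>w. c * E h $ z $ w)))"
proof (rule tridiagonal_relation_if_triple_products)
  let ?N = "diag_matrix (\<lambda>w. c * E h $ z $ w)"
  fix i j
  assume ij: "i \<le> D" "j \<le> D" "i \<noteq> j"
  consider "j = i + 1" | "i = j + 1" | "i > 1 + j \<or> j > 1 + i"
    using ij(3) by linarith
  then show "(\<theta> i)\<^sup>2 - b * \<theta> i * \<theta> j + (\<theta> j)\<^sup>2 - g * (\<theta> i + \<theta> j) - r = 0 \<or>
      (\<forall>v. E i *v (?N *v (E j *v v)) = 0)"
  proof cases
    case 1
    then show ?thesis using near[of i] ij by simp
  next
    case 2
    then show ?thesis using near[of j] ij by (simp add: algebra_simps)
  next
    case 3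
    note zero = triple_product_zero[OF krein ij(1,2) h far[OF ij(1,2) 3], of _ z]
    have "(E i *v (?N *v (E j *v v))) $ x = 0" for v x
    proof -
      have "(E i *v (?N *v (E j *v v))) $ x =
          (\<Sum>w\<in>UNIV. \<Sum>y\<in>UNIV. c * v $ y * (E i $ x $ w * E h $ z $ w * E j $ w $ y))"
        by (simp add: matrix_vector_mult_def[of "E i"] diag_matrix_mult
            matrix_vector_mult_def[of "E j"] sum_distrib_left mult_ac)
      also have "\<dots> = (\<Sum>y\<in>UNIV. c * v $ y *
          (\<Sum>w\<in>UNIV. E i $ x $ w * E h $ z $ w * E j $ w $ y))"
        by (subst sum.swap) (simp only: sum_distrib_left)
      finally show ?thesis by (simp only: zero mult_zero_right sum.neutral_const)
    qed
    then show ?thesis by (simp add: vec_eq_iff)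
  qed
qed

text \<open>The dual situation: the (x, y) entry of the commutator is M_xy (d x - d y) P(d x, d y),
  with P the quadratic polynomial of the hypothesis.\<close>

lemma tridiagonal_relation_diag_matrix:
  assumes "\<And>x y. M $ x $ y \<noteq> 0 \<Longrightarrow> d x = d y \<or>
    (d x)\<^sup>2 - b * d x * d y + (d y)\<^sup>2 - g * (d x + d y) - r = 0"
  shows "tridiagonal_relation b g r ((*v) (diag_matrix d)) ((*v) M)"
  unfolding tridiagonal_relation_def vec_eq_iff
proof (intro allI)
  fix w x
  let ?X = "(*v) (diag_matrix d)" and ?Y = "(*v) M"
  define c where "c y = (d x)\<^sup>2 - b * d x * d y + (d y)\<^sup>2 - g * (d x + d y) - r" for y
  have expr: "tridiagonal_expr b g r ?X ?Y v $ x = (\<Sum>y\<in>UNIV. M $ x $ y * c y * v $ y)" for v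
    by (simp add: tridiagonal_expr_def diag_matrix_mult matrix_vector_mult_def[of M] c_def
        algebra_simps sum.distrib sum_subtractf sum_distrib_left power2_eq_square)
  have "d x * (M $ x $ y * c y * w $ y) = M $ x $ y * c y * (d y * w $ y)" for y
    using assms[of x y] by (cases "M $ x $ y = 0") (auto simp: c_def)
  then show "(?X (tridiagonal_expr b g r ?X ?Y w)) $ x = tridiagonal_expr b g r ?X ?Y (?X w) $ x"
    by (simp only: diag_matrix_mult expr sum_distrib_left)
qed

text \<open>The maps \<open>s k\<close> are linear, jointly injective and intertwine
  \<open>X\<close>, \<open>Y\<close> with \<open>X' k\<close>, \<open>Y' k\<close>, so the identity
  may be checked after applying each of them.\<close>

lemma tridiagonal_relation_slices:
  fixes s :: "'k \<Rightarrow> complex ^ 'm \<Rightarrow> complex ^ 'n"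
  assumes add: "\<And>k u v. s k (u + v) = s k u + s k v"
    and scale: "\<And>k c v. s k (c *s v) = c *s s k v"
    and inj: "\<And>u v. (\<And>k. s k u = s k v) \<Longrightarrow> u = v"
    and X: "\<And>k v. s k (X v) = X' k (s k v)"
    and Y: "\<And>k v. s k (Y v) = Y' k (s k v)"
    and pair: "\<And>k. tridiagonal_relation b g r (X' k) (Y' k)"
  shows "tridiagonal_relation b g r X Y"
proof -
  have diff: "s k (u - v) = s k u - s k v" for k u v
    using add[of k "u - v" v] by (simp add: algebra_simps)
  have "s k (tridiagonal_expr b g r X Y v) = tridiagonal_expr b g r (X' k) (Y' k) (s k v)" for k v
    by (simp add: tridiagonal_expr_def add scale diff X Y)
  then show ?thesis
    using pair unfolding tridiagonal_relation_def by - (rule allI, rule inj, simp add: X)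
qed

section \<open>From operator identities to vanishing relators\<close>

lemma (in generator_action) eval_tridiagonal_relator:
  "eval (tridiagonal_relator (free_const b) (free_const g) (free_const r) (free_gen k) (free_gen l)) w =
     (let t = (\<lambda>w. G k (G k (G l w)) - scl b (G k (G l (G k w))) + G l (G k (G k w))
       - scl g (G k (G l w) + G l (G k w)) - scl r (G l w))
     in G k (t w) - t (G k w))"
  by (simp add: tridiagonal_relator_def commutator_def mult.assoc)

lemma (in generator_action) eval_commutator:
  "eval (commutator (free_gen k) (free_gen l)) w = G k (G l w) - G l (G k w)"
  by (simp add: commutator_def)

lemma s3_tridiagonal_module:
  fixes X Xs :: "3 \<Rightarrow> complex ^ 'n \<Rightarrow> complex ^ 'n"
  assumes lin: "\<And>i. Vector_Spaces.linear (*s) (*s) (X i)" "\<And>i. Vector_Spaces.linear (*s) (*s) (Xs i)"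
    and comm: "\<And>i j w. X i (X j w) = X j (X i w)" "\<And>i j w. Xs i (Xs j w) = Xs j (Xs i w)"
      "\<And>i w. X i (Xs i w) = Xs i (X i w)"
    and rel: "\<And>i j. i \<noteq> j \<Longrightarrow> tridiagonal_relation b g r (X i) (Xs j)"
      "\<And>i j. i \<noteq> j \<Longrightarrow> tridiagonal_relation b gs rs (Xs j) (X i)"
  shows "\<exists>act. left_algebra_module (s3_tridiagonal_algebra b g gs r rs) (*s) act \<and>
    (\<forall>i. act (s3_generator b g gs r rs (GenA i)) = X i) \<and>
    (\<forall>i. act (s3_generator b g gs r rs (GenAs i)) = Xs i)"
proof -
  define G where "G = case_s3_gen X Xs"
  have G: "G (GenA i) = X i" "G (GenAs i) = Xs i" for i
    by (simp_all add: G_def)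
  have "Vector_Spaces.linear (*s) (*s) (G k)" for k
    by (cases k) (simp_all add: G lin)
  then have act: "generator_action (*s) G"
    by (intro generator_action.intro generator_action_axioms.intro vec.vector_space_axioms)
  have tri: "generator_action.eval (*s) G (tridiagonal_relator (free_const b) (free_const g)
      (free_const r) (free_gen k) (free_gen l)) w = 0"
    if "tridiagonal_relation b g r (G k) (G l)" for b g r k l w
    using that
    by (simp add: generator_action.eval_tridiagonal_relator[OF act] tridiagonal_relation_def
        tridiagonal_expr_def)
  have "generator_action.eval (*s) G p w = 0" if "p \<in> s3_relators b g gs r rs" for p w
    using that rel comm unfolding s3_relators_def Let_def
    by (auto simp: tri G generator_action.eval_commutator[OF act])
  then show ?thesis
    using generator_action.presented_algebra_module[OF act, of "s3_relators b g gs r rs"]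
    by (auto simp: s3_tridiagonal_algebra_def s3_generator_def G)
qed

section \<open>Operators on the threefold tensor power\<close>

text \<open>Given through coefficients: an entry of the image collects the entries at neighbouring
  positions. For a symmetric relation this agrees with moving a basis vector to the sum of its
  neighbours, see \<open>adj_op_vertex_tensor\<close>.\<close>

definition adj_op :: "'v::finite rel \<Rightarrow> 3 \<Rightarrow> complex ^ ('v \<times> 'v \<times> 'v) \<Rightarrow> complex ^ ('v \<times> 'v \<times> 'v)" where
  "adj_op R i t = vec_lambda (\<lambda>(x, y, z).
     if i = 1 then \<Sum>\<xi>\<in>nbhd R x. t $ (\<xi>, y, z)
     else if i = 2 then \<Sum>\<xi>\<in>nbhd R y. t $ (x, \<xi>, z)
     else \<Sum>\<xi>\<in>nbhd R z. t $ (x, y, \<xi>))"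

definition dual_adj_op ::
    "('v::finite \<Rightarrow> 'v \<Rightarrow> complex) \<Rightarrow> 3 \<Rightarrow> complex ^ ('v \<times> 'v \<times> 'v) \<Rightarrow> complex ^ ('v \<times> 'v \<times> 'v)" where
  "dual_adj_op d i t = vec_lambda (\<lambda>(x, y, z).
     (if i = 1 then d y z else if i = 2 then d z x else d x y) * t $ (x, y, z))"

definition slice :: "3 \<Rightarrow> 'v \<times> 'v \<Rightarrow> complex ^ ('v::finite \<times> 'v \<times> 'v) \<Rightarrow> complex ^ 'v" where
  "slice i p t = (\<chi> \<xi>. t $
     (if i = 1 then (\<xi>, fst p, snd p)
      else if i = 2 then (fst p, \<xi>, snd p)
      else (fst p, snd p, \<xi>)))"

lemma slice_linear:
  "slice i p (u + v) = slice i p u + slice i p v" "slice i p (c *s v) = c *s slice i p v"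
  by (simp_all add: slice_def vec_eq_iff)

lemma slice_inj:
  assumes "\<And>p. slice i p u = slice i p v"
  shows "u = v"
proof -
  have "u $ (x, y, z) = v $ (x, y, z)" for x y z
    using assms[of "(y, z)"] assms[of "(x, z)"] assms[of "(x, y)"]
    by (auto simp: slice_def vec_eq_iff split: if_splits)
  then show ?thesis by (simp add: vec_eq_iff)
qed

lemma sum_nbhd: "(\<Sum>\<xi>\<in>nbhd R x. f \<xi>) = (\<Sum>\<xi>\<in>UNIV. adj_matrix R $ x $ \<xi> * f \<xi>)"
  by (simp add: adj_matrix_def nbhd_def if_distrib[of "\<lambda>a. a * _"] sum.If_cases cong: if_cong)

lemma slice_adj_op: "slice i p (adj_op R i t) = adj_matrix R *v slice i p t"
  by (simp add: slice_def adj_op_def vec_eq_iff matrix_vector_mult_def sum_nbhd)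

text \<open>The factor in \<open>dual_adj_op d j\<close> involves the two coordinates other than
  \<open>j\<close>. One of them is the running coordinate \<open>i\<close>, the other is constant on
  the slice. Symmetry of \<open>d\<close> absorbs the order of its arguments.\<close>

lemma slice_dual_adj_op:
  assumes "\<And>x y. d x y = d y x" and "i \<noteq> j"
  shows "\<exists>z. \<forall>t. slice i p (dual_adj_op d j t) = diag_matrix (d z) *v slice i p t"
proof -
  obtain x y where p: "p = (x, y)" by fastforce
  \<comment> \<open>The coordinate whose index differs from both \<open>i\<close> and
    \<open>j\<close>; \<open>p\<close> lists the two coordinates other than \<open>i\<close> in
    increasing order.\<close>
  define z where "z = (if j = 1 \<or> (i = 1 \<and> j = 2) then y else x)"
  have "slice i p (dual_adj_op d j t) = diag_matrix (d z) *v slice i p t" for t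
    using exhaust_3[of i] exhaust_3[of j] assms(2) assms(1)[of _ z]
    unfolding p z_def
    by (elim disjE) (simp_all add: slice_def dual_adj_op_def vec_eq_iff diag_matrix_mult)
  then show ?thesis by blast
qed

lemma adj_op_commute: "adj_op R i (adj_op R j t) = adj_op R j (adj_op R i t)"
proof -
  have "adj_op R i (adj_op R j t) $ (x, y, z) = adj_op R j (adj_op R i t) $ (x, y, z)" for x y z
    using exhaust_3[of i] exhaust_3[of j]
    by (elim disjE) (simp_all add: adj_op_def, (rule sum.swap)+)
  then show ?thesis by (simp add: vec_eq_iff)
qed

lemma dual_adj_op_commute: "dual_adj_op d i (dual_adj_op d j t) = dual_adj_op d j (dual_adj_op d i t)"
  by (simp add: dual_adj_op_def vec_eq_iff)

text \<open>The diagonal factor depends only on the two coordinates that \<open>adj_op R i\<close>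
  leaves alone.\<close>

lemma adj_op_dual_adj_op_commute: "adj_op R i (dual_adj_op d i t) = dual_adj_op d i (adj_op R i t)"
  by (simp add: adj_op_def dual_adj_op_def vec_eq_iff sum_distrib_left)

lemma linear_adj_op: "Vector_Spaces.linear (*s) (*s) (adj_op R i)"
  by unfold_locales (auto simp: adj_op_def vec_eq_iff sum.distrib sum_distrib_left)

lemma linear_dual_adj_op: "Vector_Spaces.linear (*s) (*s) (dual_adj_op d i)"
  by unfold_locales (auto simp: dual_adj_op_def vec_eq_iff algebra_simps)

lemma adj_op_vertex_tensor:
  assumes "sym R"
  shows "adj_op R 1 (vertex_tensor x y z) = (\<Sum>\<xi>\<in>nbhd R x. vertex_tensor \<xi> y z)"
    and "adj_op R 2 (vertex_tensor x y z) = (\<Sum>\<xi>\<in>nbhd R y. vertex_tensor x \<xi> z)"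
    and "adj_op R 3 (vertex_tensor x y z) = (\<Sum>\<xi>\<in>nbhd R z. vertex_tensor x y \<xi>)"
proof -
  have nbhd: "a \<in> nbhd R b \<longleftrightarrow> b \<in> nbhd R a" for a b
    using assms by (auto simp: nbhd_def dest: symD)
  \<comment> \<open>Adjacency is moved from one endpoint to the other; \<open>P\<close> and
    \<open>Q\<close> stand for the equations in the remaining coordinates.\<close>
  have delta: "(\<Sum>\<xi>\<in>nbhd R a. if P \<and> \<xi> = x \<and> Q then 1 else 0) =
      (\<Sum>\<xi>\<in>nbhd R x. if P \<and> a = \<xi> \<and> Q then 1 else (0 :: complex))" for a P x Q
    using nbhd[of a x] by (cases P; cases Q) simp_all
  show "adj_op R 1 (vertex_tensor x y z) = (\<Sum>\<xi>\<in>nbhd R x. vertex_tensor \<xi> y z)"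
    and "adj_op R 2 (vertex_tensor x y z) = (\<Sum>\<xi>\<in>nbhd R y. vertex_tensor x \<xi> z)"
    and "adj_op R 3 (vertex_tensor x y z) = (\<Sum>\<xi>\<in>nbhd R z. vertex_tensor x y \<xi>)"
    using delta[where P = True and x = x] delta[where x = y]
      delta[where P = "P1 \<and> P2" and x = z and Q = True for P1 P2]
    by (auto simp: vertex_tensor_eq_axis adj_op_def vec_eq_iff axis_def)
qed

lemma dual_adj_op_vertex_tensor:
  "dual_adj_op d 1 (vertex_tensor x y z) = d y z *s vertex_tensor x y z"
  "dual_adj_op d 2 (vertex_tensor x y z) = d z x *s vertex_tensor x y z"
  "dual_adj_op d 3 (vertex_tensor x y z) = d x y *s vertex_tensor x y z"
  by (auto simp: vertex_tensor_eq_axis dual_adj_op_def vec_eq_iff axis_def)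

section \<open>Distances along an edge and the diameter\<close>

lemma gdist_step:
  assumes "connected_simple_graph R" "(x, y) \<in> R"
  shows "gdist R z y \<le> gdist R z x + 1"
proof -
  \<comment> \<open>Connectedness guarantees that the minimum defining \<open>gdist\<close> is
    attained, so a shortest walk can be prolonged by the edge.\<close>
  have "\<exists>n. (z, x) \<in> R ^^ n"
    using assms(1) by (auto simp: connected_simple_graph_def rtrancl_power)
  then have "(z, x) \<in> R ^^ gdist R z x"
    unfolding gdist_def by (rule LeastI_ex)
  then have "(z, y) \<in> R ^^ (gdist R z x + 1)"
    using assms(2) by auto
  then show ?thesis
    unfolding gdist_def[of R z y] by (rule Least_le)
qed

lemma gdist_le_gdiameter: "gdist R x y \<le> gdiameter (R :: 'v::finite rel)"
proof -
  have "{gdist R x y | x y. True} = range (\<lambda>(x, y). gdist R x y)" by auto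
  then have "finite {gdist R x y | x y. True}" by simp
  then show ?thesis unfolding gdiameter_def by (rule Max_ge) blast
qed

theorem theorem5p4:
  fixes R :: "'v::finite rel"
    and D :: nat
    and E :: "nat \<Rightarrow> complex ^ 'v ^ 'v"
    and \<theta> \<theta>s :: "nat \<Rightarrow> complex"
    and \<beta> \<gamma> \<gamma>s \<rho> \<rho>s :: real
  assumes "distance_regular R"
    and "D = gdiameter R" and "D \<ge> 1"
    and "Q_polynomial R E"
    and "\<forall>i \<le> D. adj_matrix R ** E i = mat (\<theta> i) ** E i"
    and "\<forall>x y. \<theta>s (gdist R x y) = of_nat CARD('v) * E 1 $ x $ y"
    and "\<forall>i. 2 \<le> i \<and> i \<le> D - 1 \<longrightarrow>
           complex_of_real \<beta> + 1 = (\<theta> (i - 2) - \<theta> (i + 1)) / (\<theta> (i - 1) - \<theta> i) \<and>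
           complex_of_real \<beta> + 1 = (\<theta>s (i - 2) - \<theta>s (i + 1)) / (\<theta>s (i - 1) - \<theta>s i)"
    and "\<forall>i. 1 \<le> i \<and> i \<le> D - 1 \<longrightarrow>
           complex_of_real \<gamma> = \<theta> (i - 1) - complex_of_real \<beta> * \<theta> i + \<theta> (i + 1) \<and>
           complex_of_real \<gamma>s = \<theta>s (i - 1) - complex_of_real \<beta> * \<theta>s i + \<theta>s (i + 1)"
    and "\<forall>i. 1 \<le> i \<and> i \<le> D \<longrightarrow>
           complex_of_real \<rho> = (\<theta> (i - 1))\<^sup>2 - complex_of_real \<beta> * \<theta> (i - 1) * \<theta> i + (\<theta> i)\<^sup>2
              - complex_of_real \<gamma> * (\<theta> (i - 1) + \<theta> i) \<and>
           complex_of_real \<rho>s = (\<theta>s (i - 1))\<^sup>2 - complex_of_real \<beta> * \<theta>s (i - 1) * \<theta>s i + (\<theta>s i)\<^sup>2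
              - complex_of_real \<gamma>s * (\<theta>s (i - 1) + \<theta>s i)"
  shows "let T = s3_tridiagonal_algebra (complex_of_real \<beta>) (complex_of_real \<gamma>)
                   (complex_of_real \<gamma>s) (complex_of_real \<rho>) (complex_of_real \<rho>s);
             gen = s3_generator (complex_of_real \<beta>) (complex_of_real \<gamma>)
                   (complex_of_real \<gamma>s) (complex_of_real \<rho>) (complex_of_real \<rho>s)
         in \<exists>act :: (s3_gen, complex) free_algebra set \<Rightarrow>
                 complex ^ ('v \<times> 'v \<times> 'v) \<Rightarrow> complex ^ ('v \<times> 'v \<times> 'v).
           left_algebra_module T (*s) act \<and>
           (\<forall>x y z.
              act (gen (GenA 1)) (vertex_tensor x y z) = (\<Sum>\<xi>\<in>nbhd R x. vertex_tensor \<xi> y z) \<and>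
              act (gen (GenA 2)) (vertex_tensor x y z) = (\<Sum>\<xi>\<in>nbhd R y. vertex_tensor x \<xi> z) \<and>
              act (gen (GenA 3)) (vertex_tensor x y z) = (\<Sum>\<xi>\<in>nbhd R z. vertex_tensor x y \<xi>) \<and>
              act (gen (GenAs 1)) (vertex_tensor x y z) = \<theta>s (gdist R y z) *s vertex_tensor x y z \<and>
              act (gen (GenAs 2)) (vertex_tensor x y z) = \<theta>s (gdist R z x) *s vertex_tensor x y z \<and>
              act (gen (GenAs 3)) (vertex_tensor x y z) = \<theta>s (gdist R x y) *s vertex_tensor x y z)"
proof -
  have graph: "connected_simple_graph R"
    using assms(1) by (simp add: distance_regular_def)
  then have symR: "sym R" by (simp add: connected_simple_graph_def)
  let ?A = "adj_matrix R" and ?d = "\<lambda>x y. \<theta>s (gdist R x y)"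
  let ?b = "complex_of_real \<beta>" and ?g = "complex_of_real \<gamma>" and ?gs = "complex_of_real \<gamma>s"
    and ?r = "complex_of_real \<rho>" and ?rs = "complex_of_real \<rho>s"
  obtain q where bij: "bij_betw E {0..D} {P. primitive_idempotent ?A P}"
    and krein: "krein_parameters D E q"
    and triangle: "\<And>h i j. h \<le> D \<Longrightarrow> i \<le> D \<Longrightarrow> j \<le> D \<Longrightarrow>
      h > i + j \<or> i > h + j \<or> j > h + i \<Longrightarrow> q h i j = 0"
    using assms(2,4) unfolding Q_polynomial_def Let_def by blast
  have sd: "spectral_decomposition ?A D E \<theta>"
    using bij assms(5) symR
    by unfold_locales (auto simp: adj_matrix_def dest: symD)
  have d_entry: "?d x y = of_nat CARD('v) * E 1 $ x $ y" for x y
    using assms(6) by blast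
  \<comment> \<open>Symmetry of the dual eigenvalue in its two vertices is read off from the
    symmetry of \<open>E 1\<close>.\<close>
  have d_sym: "?d x y = ?d y x" for x y
    using d_entry[of x y] d_entry[of y x] spectral_decomposition.E_sym[OF sd assms(3), of x y]
    by simp
  \<comment> \<open>The diagonal of the dual adjacency matrix at \<open>z\<close> is row
    \<open>z\<close> of |X| E_1; the index 1 is legitimate because D \<ge> 1.\<close>
  have rel: "tridiagonal_relation ?b ?g ?r ((*v) ?A) ((*v) (diag_matrix (?d z)))" for z
    unfolding d_entry
  proof (rule spectral_decomposition.tridiagonal_relation_idempotent_row[OF sd krein assms(3)])
    show "q 1 i j = 0" if "i \<le> D" "j \<le> D" "i > 1 + j \<or> j > 1 + i" for i j
      using triangle[OF assms(3) that(1,2)] that(3) by auto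
    show "(\<theta> i)\<^sup>2 - ?b * \<theta> i * \<theta> (i + 1) + (\<theta> (i + 1))\<^sup>2 - ?g * (\<theta> i + \<theta> (i + 1)) - ?r = 0"
      if "i < D" for i
      \<comment> \<open>Condition (iii) compares the indices i - 1 and i, hence the shift to i +
        1.\<close>
      using assms(9)[rule_format, of "i + 1"] that by simp
  qed
  have rel_dual: "tridiagonal_relation ?b ?gs ?rs ((*v) (diag_matrix (?d z))) ((*v) ?A)" for z
  proof (rule tridiagonal_relation_diag_matrix)
    fix x y
    assume "?A $ x $ y \<noteq> 0"
    then have xy: "(x, y) \<in> R" "(y, x) \<in> R"
      using symR by (auto simp: adj_matrix_def dest: symD split: if_splits)
    have le: "gdist R z x \<le> D" "gdist R z y \<le> D"
      using gdist_le_gdiameter assms(2) by auto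
    \<comment> \<open>Equal distances make the commutator entry vanish; otherwise condition (iii)
      applies at the larger distance, which lies between 1 and \<open>D\<close>.\<close>
    consider "gdist R z x = gdist R z y" | "gdist R z y = gdist R z x + 1"
      | "gdist R z x = gdist R z y + 1"
      using gdist_step[OF graph xy(1), of z] gdist_step[OF graph xy(2), of z] by linarith
    then show "?d z x = ?d z y \<or>
        (?d z x)\<^sup>2 - ?b * ?d z x * ?d z y + (?d z y)\<^sup>2 - ?gs * (?d z x + ?d z y) - ?rs = 0"
    proof cases
      case 2
      then show ?thesis using assms(9)[rule_format, of "gdist R z y"] le by simp
    next
      case 3
      then show ?thesis
        using assms(9)[rule_format, of "gdist R z x"] le by (simp add: algebra_simps)
    qed simp
  qed
  have pairs: "tridiagonal_relation ?b ?g ?r (adj_op R i) (dual_adj_op ?d j)"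
    "tridiagonal_relation ?b ?gs ?rs (dual_adj_op ?d j) (adj_op R i)" if ij: "i \<noteq> j" for i j
  proof -
    \<comment> \<open>The base vertex of the diagonal matrix varies with the slice, so
      \<open>z\<close> becomes a function of \<open>p\<close>.\<close>
    obtain z where z: "\<And>p t. slice i p (dual_adj_op ?d j t) = diag_matrix (?d (z p)) *v slice i p t"
      using slice_dual_adj_op[of ?d, OF d_sym ij] by metis
    show "tridiagonal_relation ?b ?g ?r (adj_op R i) (dual_adj_op ?d j)"
    proof (rule tridiagonal_relation_slices[where s = "slice i" and X' = "\<lambda>_. (*v) ?A"
          and Y' = "\<lambda>p. (*v) (diag_matrix (?d (z p)))"])
      show "u = v" if "\<And>p. slice i p u = slice i p v" for u v
        using that by (rule slice_inj)
    qed (simp_all add: slice_linear slice_adj_op z rel)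
    show "tridiagonal_relation ?b ?gs ?rs (dual_adj_op ?d j) (adj_op R i)"
    proof (rule tridiagonal_relation_slices[where s = "slice i" and Y' = "\<lambda>_. (*v) ?A"
          and X' = "\<lambda>p. (*v) (diag_matrix (?d (z p)))"])
      show "u = v" if "\<And>p. slice i p u = slice i p v" for u v
        using that by (rule slice_inj)
    qed (simp_all add: slice_linear slice_adj_op z rel_dual)
  qed
  have "\<exists>act. left_algebra_module (s3_tridiagonal_algebra ?b ?g ?gs ?r ?rs) (*s) act \<and>
      (\<forall>i. act (s3_generator ?b ?g ?gs ?r ?rs (GenA i)) = adj_op R i) \<and>
      (\<forall>i. act (s3_generator ?b ?g ?gs ?r ?rs (GenAs i)) = dual_adj_op ?d i)"
    by (rule s3_tridiagonal_module[OF linear_adj_op linear_dual_adj_op adj_op_commute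
          dual_adj_op_commute adj_op_dual_adj_op_commute pairs])
  then show ?thesis
    unfolding Let_def
    by (elim exE, intro exI)
      (auto simp: adj_op_vertex_tensor[OF symR] dual_adj_op_vertex_tensor)
qed

end
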